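(* Let $A=\langle\alpha\rangle$ be an infinite cyclic discrete group and $M$ a nonzero LC $A$-module on which $\alpha$ acts as a contracting automorphism. Suppose that $mM=\{0\}$ for some integer $m\ge1$ and that $M$ is indecomposable (not the topological direct sum of two nonzero closed submodules). Then there exist a prime $p$ and $n\ge1$ such that $M$ is isomorphic, as a topological $A$-module, to $(\mathbf{Z}/p^n\mathbf{Z})(\!(t)\!)$ with its $t$-adic topology and $\alpha$ acting by multiplication by $t$.
   Context: An LC $A$-module is an LCA group with a continuous action of $A$ by topological automorphisms. An automorphism is contracting if $\alpha^n x\to 0$ as $n\to+\infty$ for every $x$. $(\mathbf{Z}/p^n\mathbf{Z})(\!(t)\!)$ denotes the ring of formal Laurent series $\sum_{k\ge k_0}a_kt^k$ with coefficients in $\mathbf{Z}/p^n\mathbf{Z}$. *)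

theory Defs
  imports "HOL-Analysis.Analysis"
begin

definition nat_mult :: "nat \<Rightarrow> 'a::ab_group_add \<Rightarrow> 'a" where
  "nat_mult m x = (\<Sum>i<m. x)"

text \<open>A closed A-submodule of M (A generated by the automorphism alpha):
  a closed subgroup N with alpha ` N = N (stable under alpha and alpha inverse).\<close>
definition closed_submodule :: "('a::{topological_ab_group_add} \<Rightarrow> 'a) \<Rightarrow> 'a set \<Rightarrow> bool" where
  "closed_submodule \<alpha> N \<longleftrightarrow> closed N \<and> 0 \<in> N \<and> (\<forall>x\<in>N. \<forall>y\<in>N. x + y \<in> N)
      \<and> (\<forall>x\<in>N. - x \<in> N) \<and> \<alpha> ` N = N"

definition indecomposable :: "('a::{topological_ab_group_add} \<Rightarrow> 'a) \<Rightarrow> bool" where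
  "indecomposable \<alpha> \<longleftrightarrow> \<not> (\<exists>N1 N2. closed_submodule \<alpha> N1 \<and> closed_submodule \<alpha> N2
      \<and> N1 \<noteq> {0} \<and> N2 \<noteq> {0}
      \<and> homeomorphic_map (prod_topology (subtopology euclidean N1) (subtopology euclidean N2))
            euclidean (\<lambda>(a, b). a + b))"

text \<open>(Z/qZ)((t)) with q = p^n: formal Laurent series sum_k a_k t^k, represented by the
  coefficient function k \<mapsto> a_k with a_k in {0..<q} and a_k = 0 for k small enough.\<close>
definition laurent :: "int \<Rightarrow> (int \<Rightarrow> int) set" where
  "laurent q = {f. (\<forall>k. 0 \<le> f k \<and> f k < q) \<and> (\<exists>k0. \<forall>k<k0. f k = 0)}"

definition laurent_add :: "int \<Rightarrow> (int \<Rightarrow> int) \<Rightarrow> (int \<Rightarrow> int) \<Rightarrow> (int \<Rightarrow> int)" where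
  "laurent_add q f g = (\<lambda>k. (f k + g k) mod q)"

definition laurent_shift :: "(int \<Rightarrow> int) \<Rightarrow> (int \<Rightarrow> int)" where
  "laurent_shift f = (\<lambda>k. f (k - 1))"

text \<open>t-adic topology: basic neighbourhoods of f are f + t^j (Z/qZ)[[t]].\<close>
definition laurent_top :: "int \<Rightarrow> (int \<Rightarrow> int) topology" where
  "laurent_top q = topology (\<lambda>U. U \<subseteq> laurent q \<and>
      (\<forall>f\<in>U. \<exists>j. {g \<in> laurent q. \<forall>k<j. g k = f k} \<subseteq> U))"

end

theory Submission
  imports Defs "HOL-Number_Theory.Cong"
begin

text \<open>
  Bounded exponent turns a compact neighbourhood of \<open>0\<close> into a compact open subgroup, and Baire's
  theorem makes the contraction uniform on it, so there is a compact open subgroup \<open>K\<close> with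
  \<open>\<alpha> K \<subseteq> K\<close> whose images \<open>U i = \<alpha>\<^sup>i K\<close> form a basis at \<open>0\<close> and exhaust \<open>M\<close>.
  By indecomposability the exact exponent is a prime power \<open>q = p\<^sup>n\<close>.

  A continuous homomorphism \<open>\<psi> : M \<rightarrow> \<int>/q\<close> induces a continuous equivariant homomorphism
  \<open>x \<mapsto> (\<psi> (\<alpha>\<^sup>-\<^sup>k x))\<^sub>k\<close> from \<open>M\<close> to \<open>(\<int>/q)((t))\<close>. If \<open>\<psi>\<close> takes the value \<open>1\<close>, this map is
  surjective: modulo \<open>p\<close> one solves for the coefficients successively and passes to the limit by
  compactness, and then one lifts to \<open>p\<^sup>n\<close>. With \<open>y\<close> a preimage of \<open>1\<close>, the map
  \<open>x \<mapsto> \<Sum>\<^sub>k \<psi> (\<alpha>\<^sup>-\<^sup>k x) \<alpha>\<^sup>k y\<close> is a nonzero continuous equivariant idempotent with the same kernel.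
  Indecomposability forces it to be the identity.
\<close>

subsection \<open>Abelian groups as integer modules\<close>

text \<open>Splitting \<open>k\<close> into positive and negative part makes every abelian group a
  \<open>module\<close> over the integers, so that spans and subspaces serve as generated subgroups
  and subgroups.\<close>

definition int_mult :: "int \<Rightarrow> 'a::ab_group_add \<Rightarrow> 'a" (infixr \<open>\<cdot>\<close> 75) where
  "k \<cdot> x = nat_mult (nat k) x - nat_mult (nat (- k)) x"

lemma nat_mult_0 [simp]: "nat_mult 0 x = 0"
  by (simp add: nat_mult_def)

lemma nat_mult_Suc [simp]: "nat_mult (Suc n) x = nat_mult n x + x"
  by (simp add: nat_mult_def)

lemma nat_mult_diff:
  assumes "b \<le> a"
  shows "nat_mult (a - b) x = nat_mult a x - nat_mult b x"
  using assms by (induction a rule: dec_induct) (simp_all add: Suc_diff_le)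

text \<open>Any representation of an integer as a difference gives the same multiple; additivity in
  the scalar then reduces to natural numbers without a distinction of signs.\<close>

lemma int_mult_of_diff: "(int a - int b) \<cdot> x = nat_mult a x - nat_mult b x"
proof (cases "b \<le> a")
  case True
  then have "nat (int a - int b) = a - b" "nat (int b - int a) = 0" by auto
  then show ?thesis using True by (simp add: int_mult_def nat_mult_diff)
next
  case False
  then have "nat (int a - int b) = 0" "nat (int b - int a) = b - a" by auto
  then show ?thesis using False by (simp add: int_mult_def nat_mult_diff)
qed

lemma int_mult_of_nat: "int a \<cdot> x = nat_mult a x"
  using int_mult_of_diff[of a 0 x] by simp

lemma int_mult_add_left: "(a + b) \<cdot> x = a \<cdot> x + b \<cdot> x"
proof -
  have add: "nat_mult (c + d) x = nat_mult c x + nat_mult d x" for c d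
    by (induction d) (simp_all add: algebra_simps)
  obtain a1 a2 b1 b2 where ab: "a = int a1 - int a2" "b = int b1 - int b2"
    by (metis int_diff_cases)
  then have "a + b = int (a1 + b1) - int (a2 + b2)" by simp
  then show ?thesis
    unfolding ab by (metis (no_types, lifting) ab(1,2) add add_diff_add int_mult_of_diff)
qed

lemma int_mult_additive:
  assumes "\<And>x y. f (x + y) = f x + f y"
  shows "f (k \<cdot> x) = k \<cdot> f x"
proof -
  interpret additive f by standard (rule assms)
  have "f (nat_mult n x) = nat_mult n (f x)" for n
    by (induction n) (simp_all add: zero add)
  then show ?thesis by (simp add: int_mult_def diff)
qed

interpretation int_module: module int_mult
proof
  show distrib: "a \<cdot> (x + y) = a \<cdot> x + a \<cdot> y" for a :: int and x y :: 'a
  proof -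
    have "nat_mult n (x + y) = nat_mult n x + nat_mult n y" for n
      by (induction n) (simp_all add: algebra_simps)
    then show ?thesis by (simp add: int_mult_def)
  qed
  show "(a + b) \<cdot> x = a \<cdot> x + b \<cdot> x" for a b :: int and x :: 'a
    by (rule int_mult_add_left)
  show "1 \<cdot> x = x" for x :: 'a
    by (simp add: int_mult_def)
  show "a \<cdot> b \<cdot> x = (a * b) \<cdot> x" for a b :: int and x :: 'a
  proof (induction a rule: int_induct[where k = 0])
    case base
    show ?case by (simp add: int_mult_def)
  next
    case (step1 i)
    have "(i + 1) \<cdot> b \<cdot> x = i \<cdot> b \<cdot> x + b \<cdot> x"
      by (simp add: int_mult_add_left) (simp add: int_mult_def)
    then show ?case using step1 by (simp add: distrib_right int_mult_add_left)
  next
    case (step2 i)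
    have "(i - 1 + 1) \<cdot> b \<cdot> x = (i - 1) \<cdot> b \<cdot> x + b \<cdot> x"
      unfolding int_mult_add_left by (simp add: int_mult_def)
    moreover have "((i - 1) * b + b) \<cdot> x = ((i - 1) * b) \<cdot> x + b \<cdot> x"
      by (rule int_mult_add_left)
    ultimately show ?case using step2 by (simp add: algebra_simps)
  qed
qed

abbreviation subgroup :: "'a::ab_group_add set \<Rightarrow> bool" where
  "subgroup \<equiv> int_module.subspace"

lemma subgroupI:
  assumes "0 \<in> S" "\<And>x y. x \<in> S \<Longrightarrow> y \<in> S \<Longrightarrow> x + y \<in> S" "\<And>x. x \<in> S \<Longrightarrow> - x \<in> S"
  shows "subgroup S"
proof (rule int_module.subspaceI)
  fix c x assume x: "x \<in> S"
  have "nat_mult n x \<in> S" for n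
    using assms x by (induction n) auto
  then show "c \<cdot> x \<in> S"
    using assms(2,3) by (metis (no_types) int_mult_def uminus_add_conv_diff add.commute)
qed (use assms in auto)

lemma int_mult_eq_if_cong:
  assumes "q \<cdot> x = 0" "[a = b] (mod q)"
  shows "a \<cdot> x = b \<cdot> x"
proof -
  obtain t where "a = b + q * t"
    using cong_sym[OF assms(2)] unfolding cong_iff_lin by auto
  then have "a \<cdot> x = b \<cdot> x + t \<cdot> (q \<cdot> x)"
    by (simp add: int_module.scale_left_distrib mult.commute)
  then show ?thesis using assms(1) by simp
qed

text \<open>Each further generator \<open>a\<close> contributes only the multiples
  \<open>k \<cdot> a\<close> with \<open>0 \<le> k < m\<close>, so a finite span grows to finitely
  many translates of itself.\<close>

lemma finite_span_if_exponent:
  fixes F :: "'a::ab_group_add set"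
  assumes "finite F" "m > 0" "\<And>x::'a. m \<cdot> x = 0"
  shows "finite (int_module.span F)"
  using \<open>finite F\<close>
proof (induction F)
  case (insert a F)
  have "int_module.span (insert a F) \<subseteq> (\<Union>k\<in>{0..<m}. (\<lambda>y. y + k \<cdot> a) ` int_module.span F)"
  proof
    fix x assume "x \<in> int_module.span (insert a F)"
    then obtain k where k: "x - k \<cdot> a \<in> int_module.span F"
      by (auto simp: int_module.span_insert)
    have "k \<cdot> a = (k mod m) \<cdot> a"
      by (rule int_mult_eq_if_cong[of m]) (use assms in \<open>auto simp: cong_def\<close>)
    moreover have "x = x - k \<cdot> a + k \<cdot> a" by simp
    ultimately show "x \<in> (\<Union>k\<in>{0..<m}. (\<lambda>y. y + k \<cdot> a) ` int_module.span F)"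
      using k assms(2) by (intro UN_I[of "k mod m"] image_eqI[of _ _ "x - k \<cdot> a"]) auto
  qed
  then show ?case using insert by (auto intro: finite_subset)
qed auto

text \<open>A subgroup maximal among those that contain \<open>U\<close> and miss \<open>p\<^sup>r \<cdot> x0\<close> is a complement of the
  cyclic subgroup generated by \<open>x0\<close>, and \<open>\<psi>\<close> is the resulting coordinate.\<close>
lemma exists_coordinate_character:
  fixes x0 :: "'a::ab_group_add"
  assumes p: "prime (p::int)" and expo: "\<And>x::'a. (p ^ Suc r) \<cdot> x = 0"
    and U: "subgroup U" and x0: "p ^ r \<cdot> x0 \<notin> U"
  obtains \<psi> :: "'a \<Rightarrow> int"
  where "\<And>x. 0 \<le> \<psi> x" "\<And>x. \<psi> x < p ^ Suc r"
    "\<And>x y. \<psi> (x + y) = (\<psi> x + \<psi> y) mod p ^ Suc r"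
    "\<And>u. u \<in> U \<Longrightarrow> \<psi> u = 0" "\<psi> x0 = 1"
proof -
  let ?q = "p ^ Suc r"
  have p1: "p > 1" using p by (simp add: prime_gt_1_int)
  then have q1: "?q > 1" by (simp add: one_less_power del: power_Suc)
  define \<A> where "\<A> = {W. subgroup W \<and> U \<subseteq> W \<and> p ^ r \<cdot> x0 \<notin> W}"
  have "\<exists>W\<in>\<A>. \<forall>X\<in>\<A>. W \<subseteq> X \<longrightarrow> X = W"
  proof (rule subset_Zorn_nonempty)
    show "\<A> \<noteq> {}" using U x0 by (auto simp: \<A>_def)
    fix \<C> assume C: "\<C> \<noteq> {}" "subset.chain \<A> \<C>"
    have sub: "W \<in> \<A>" if "W \<in> \<C>" for W using C that by (auto simp: subset.chain_def)
    have tot: "V \<subseteq> W \<or> W \<subseteq> V" if "V \<in> \<C>" "W \<in> \<C>" for V W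
      using C that by (auto simp: subset.chain_def)
    have "subgroup (\<Union>\<C>)"
    proof (rule subgroupI)
      show "0 \<in> \<Union>\<C>" using C(1) sub by (auto simp: \<A>_def int_module.subspace_0)
      show "x + y \<in> \<Union>\<C>" if xy: "x \<in> \<Union>\<C>" "y \<in> \<Union>\<C>" for x y
      proof -
        obtain V W where VW: "V \<in> \<C>" "W \<in> \<C>" "x \<in> V" "y \<in> W" using xy by auto
        then obtain X where "X \<in> \<C>" "x \<in> X" "y \<in> X" using tot by blast
        then show ?thesis using sub[of X] int_module.subspace_add[of X x y] by (auto simp: \<A>_def)
      qed
      show "- x \<in> \<Union>\<C>" if "x \<in> \<Union>\<C>" for x
        using that sub by (auto simp: \<A>_def dest: int_module.subspace_neg)
    qed
    moreover have "U \<subseteq> \<Union>\<C>" using C(1) sub by (auto simp: \<A>_def)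
    ultimately show "\<Union>\<C> \<in> \<A>" using sub by (auto simp: \<A>_def)
  qed
  then obtain W where "W \<in> \<A>" and W_max: "\<forall>X\<in>\<A>. W \<subseteq> X \<longrightarrow> X = W" by blast
  then have W: "subgroup W" "U \<subseteq> W" "p ^ r \<cdot> x0 \<notin> W" by (auto simp: \<A>_def)
  have max: "X = W" if "subgroup X" "W \<subseteq> X" "p ^ r \<cdot> x0 \<notin> X" for X
    using W_max W(2) that unfolding \<A>_def by (metis (mono_tags, lifting) mem_Collect_eq order_trans)
  note Wadd = int_module.subspace_add[OF W(1)] and Wdiff = int_module.subspace_diff[OF W(1)]
    and Wscale = int_module.subspace_scale[OF W(1)]
  \<comment> \<open>The order of \<open>x0\<close> modulo \<open>W\<close> is the full
    \<open>p ^ Suc r\<close>: otherwise the gcd of \<open>a\<close> and \<open>p ^ Suc r\<close> is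
    some \<open>p ^ i\<close> with \<open>i \<le> r\<close>, and \<open>W\<close> would contain
    \<open>p ^ r \<cdot> x0\<close>.\<close>
  have dvd: "?q dvd a" if a: "a \<cdot> x0 \<in> W" for a
  proof (rule ccontr)
    assume na: "\<not> ?q dvd a"
    define g where "g = gcd a ?q"
    obtain u v where uv: "u * a + v * ?q = g"
      unfolding g_def by (metis bezout_int)
    have "g \<cdot> x0 = u \<cdot> (a \<cdot> x0) + v \<cdot> (?q \<cdot> x0)"
      unfolding uv[symmetric] by (simp only: int_module.scale_left_distrib int_module.scale_scale)
    then have g: "g \<cdot> x0 \<in> W" using Wscale[OF a, of u] by (simp only: expo int_module.scale_zero_right add_0_right)
    have "g dvd ?q" "normalize g = g" unfolding g_def by (rule gcd_dvd2, rule normalize_gcd)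
    then obtain i where i: "i \<le> Suc r" "g = p ^ i"
      using divides_primepow[OF p] by metis
    have "i \<noteq> Suc r" using na i g_def by (metis gcd_dvd1)
    then have "i \<le> r" using i by simp
    then have "p ^ r = p ^ (r - i) * g" using i by (simp add: power_add[symmetric])
    then have "p ^ r \<cdot> x0 = p ^ (r - i) \<cdot> (g \<cdot> x0)" by simp
    then show False using W(3) Wscale[OF g] by simp
  qed
  have ex: "\<exists>a. x - a \<cdot> x0 \<in> W" for x
  proof -
    \<comment> \<open>\<open>N\<close> is the sum of \<open>W\<close> and the multiples of
      \<open>x0\<close>. It is closed under division by \<open>p\<close> and contains
      \<open>p ^ Suc r \<cdot> x = 0\<close>, so \<open>Suc r\<close> divisions reach every
      \<open>x\<close>.\<close>
    define N where "N = {x. \<exists>a. x - a \<cdot> x0 \<in> W}"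
    have N: "subgroup N"
    proof (rule subgroupI)
      show "0 \<in> N" unfolding N_def using int_module.subspace_0[OF W(1)] by (auto intro!: exI[of _ 0])
      show "x + y \<in> N" if "x \<in> N" "y \<in> N" for x y
      proof -
        obtain a b where ab: "x - a \<cdot> x0 \<in> W" "y - b \<cdot> x0 \<in> W" using \<open>x \<in> N\<close> \<open>y \<in> N\<close> by (auto simp: N_def)
        have "x + y - (a + b) \<cdot> x0 \<in> W" using Wadd[OF ab] by (simp add: algebra_simps int_module.scale_left_distrib)
        then show ?thesis unfolding N_def by blast
      qed
      show "- x \<in> N" if x: "x \<in> N" for x
      proof -
        obtain a where "x - a \<cdot> x0 \<in> W" using x by (auto simp: N_def)
        from int_module.subspace_neg[OF W(1) this] have "- x - (- a) \<cdot> x0 \<in> W" by simp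
        then show ?thesis unfolding N_def by blast
      qed
    qed
    have WN: "W \<subseteq> N" unfolding N_def by (auto intro!: exI[of _ 0])
    have x0N: "x0 \<in> N" unfolding N_def using int_module.subspace_0[OF W(1)] by (auto intro!: exI[of _ 1])
    have step: "x \<in> N" if px: "p \<cdot> x \<in> N" for x
    proof (rule ccontr)
      assume nx: "x \<notin> N"
      obtain a where "p \<cdot> x - a \<cdot> x0 \<in> W" using px by (auto simp: N_def)
      then obtain w where aw: "p \<cdot> x = a \<cdot> x0 + w" "w \<in> W" by (metis add.commute diff_add_cancel)
      \<comment> \<open>Multiplying by \<open>p ^ r\<close> annihilates \<open>p \<cdot> x\<close>,
        which forces \<open>p\<close> to divide \<open>a\<close>; subtracting
        \<open>a' \<cdot> x0\<close> then yields an element outside \<open>N\<close> whose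
        \<open>p\<close>-fold lies in \<open>W\<close>.\<close>
      have "p ^ r \<cdot> (p \<cdot> x) = 0" using expo[of x] by (simp add: mult.commute)
      then have "(p ^ r * a) \<cdot> x0 = - (p ^ r \<cdot> w)"
        unfolding aw by (simp add: int_module.scale_right_distrib eq_neg_iff_add_eq_0)
      then have "(p ^ r * a) \<cdot> x0 \<in> W"
        using int_module.subspace_neg[OF W(1) Wscale[OF aw(2)]] by simp
      then have "?q dvd p ^ r * a" by (rule dvd)
      then have "p dvd a" using p1 by (simp add: mult.commute)
      then obtain a' where a': "a = p * a'" by auto
      define x' where "x' = x - a' \<cdot> x0"
      have px': "p \<cdot> x' = w"
        unfolding x'_def int_module.scale_right_diff_distrib using aw a' by simp
      have nx': "x' \<notin> N"
      proof
        assume "x' \<in> N"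
        from int_module.subspace_add[OF N this int_module.subspace_scale[OF N x0N, of a']]
        show False using nx by (simp add: x'_def)
      qed
      define X where "X = int_module.span (insert x' W)"
      have spW: "int_module.span W = W" using W(1) by (simp add: int_module.span_eq_iff)
      have "x' \<in> X" unfolding X_def by (simp add: int_module.span_base)
      then have "X \<noteq> W" using nx' WN by auto
      moreover have "subgroup X" "W \<subseteq> X" unfolding X_def
        using int_module.span_superset[of "insert x' W"] by auto
      ultimately have "p ^ r \<cdot> x0 \<in> X" using max by blast
      then obtain c where c: "p ^ r \<cdot> x0 - c \<cdot> x' \<in> W"
        by (auto simp: X_def int_module.span_insert spW)
      \<comment> \<open>By maximality \<open>p ^ r \<cdot> x0\<close> is congruent to
        \<open>c \<cdot> x'\<close> modulo \<open>W\<close>. If \<open>p\<close> divides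
        \<open>c\<close>, that multiple already lies in \<open>W\<close>; if not, Bezout recovers
        \<open>x'\<close> from \<open>c \<cdot> x'\<close> and \<open>p \<cdot> x'\<close>, both in
        \<open>N\<close>.\<close>
      show False
      proof (cases "p dvd c")
        case True
        then obtain d where "c = d * p" by (metis dvd_div_mult_self)
        then have "c \<cdot> x' = d \<cdot> w" using px' by (metis int_module.scale_scale)
        then have "c \<cdot> x' \<in> W" using Wscale[OF aw(2)] by simp
        from Wadd[OF c this] show False using W(3) by simp
      next
        case False
        then have "coprime c p" using p by (metis coprime_commute prime_imp_coprime)
        then obtain u v where uv: "u * c + v * p = 1"
          by (metis bezout_int coprime_iff_gcd_eq_1)
        have "x' = u \<cdot> (c \<cdot> x') + v \<cdot> (p \<cdot> x')"
          by (metis uv int_module.scale_left_distrib int_module.scale_one int_module.scale_scale)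
        moreover have "c \<cdot> x' \<in> N"
        proof -
          have "p ^ r \<cdot> x0 \<in> N" using x0N N by (rule int_module.subspace_scale[rotated])
          from int_module.subspace_diff[OF N this subsetD[OF WN c]] show ?thesis by simp
        qed
        moreover have "p \<cdot> x' \<in> N" using px' aw(2) WN by auto
        ultimately have "x' \<in> N" using N by (metis int_module.subspace_add int_module.subspace_scale)
        then show False using nx' by simp
      qed
    qed
    have "p ^ i \<cdot> x \<in> N \<Longrightarrow> x \<in> N" for i
    proof (induction i)
      case (Suc i)
      have "p \<cdot> (p ^ i \<cdot> x) \<in> N" using Suc.prems by simp
      then show ?case using step Suc.IH by blast
    qed simp
    moreover have "?q \<cdot> x \<in> N" using expo int_module.subspace_0[OF N] by simp
    ultimately show ?thesis unfolding N_def by blast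
  qed
  \<comment> \<open>The chosen coefficient is unique modulo \<open>p ^ Suc r\<close> by
    \<open>dvd\<close>, so its residue does not depend on the choice and is additive.\<close>
  define \<psi> where "\<psi> x = (SOME a. x - a \<cdot> x0 \<in> W) mod ?q" for x
  have \<psi>: "x - \<psi> x \<cdot> x0 \<in> W" for x
  proof -
    have "x - (SOME a. x - a \<cdot> x0 \<in> W) \<cdot> x0 \<in> W" using ex by (rule someI_ex)
    moreover have "(SOME a. x - a \<cdot> x0 \<in> W) \<cdot> x0 = \<psi> x \<cdot> x0"
      by (rule int_mult_eq_if_cong[OF expo]) (simp add: \<psi>_def cong_def del: power_Suc)
    ultimately show ?thesis by simp
  qed
  have bd: "0 \<le> \<psi> x" "\<psi> x < ?q" for x
    using q1 by (simp_all add: \<psi>_def del: power_Suc)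
  have uniq: "\<psi> x = a mod ?q" if "x - a \<cdot> x0 \<in> W" for x a
  proof -
    have "(x - a \<cdot> x0) - (x - \<psi> x \<cdot> x0) \<in> W" using that \<psi> by (rule Wdiff)
    then have "?q dvd \<psi> x - a" by (intro dvd) (simp add: int_module.scale_left_diff_distrib)
    then have "\<psi> x mod ?q = a mod ?q" by (simp add: mod_eq_dvd_iff)
    then show ?thesis using bd[of x] by (simp del: power_Suc)
  qed
  show thesis
  proof
    show "0 \<le> \<psi> x" "\<psi> x < ?q" for x by (fact bd)+
    show "\<psi> (x + y) = (\<psi> x + \<psi> y) mod ?q" for x y
      by (rule uniq) (use Wadd[OF \<psi>[of x] \<psi>[of y]] in \<open>simp add: algebra_simps int_module.scale_left_distrib\<close>)
    show "\<psi> u = 0" if "u \<in> U" for u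
      using uniq[of u 0] that W(2) by auto
    show "\<psi> x0 = 1"
      using uniq[of x0 1] int_module.subspace_0[OF W(1)] q1 by (simp del: power_Suc)
  qed
qed

subsection \<open>Contractions of locally compact groups\<close>

text \<open>The fixed points and the kernel of \<open>e\<close> are closed submodules, and
  \<open>x \<mapsto> (e x, x - e x)\<close> is a continuous inverse of their addition map; a
  nontrivial \<open>e\<close> would thus decompose the group.\<close>

lemma indecomposable_imp_trivial_idempotent:
  fixes \<alpha> e :: "'a::{topological_ab_group_add, t2_space} \<Rightarrow> 'a"
  assumes indec: "indecomposable \<alpha>" and bij: "bij \<alpha>"
    and add: "\<And>x y. \<alpha> (x + y) = \<alpha> x + \<alpha> y"
    and e_add: "\<And>x y. e (x + y) = e x + e y" and cont: "continuous_on UNIV e"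
    and idem: "\<And>x. e (e x) = e x" and comm: "\<And>x. e (\<alpha> x) = \<alpha> (e x)"
  shows "(\<forall>x. e x = 0) \<or> (\<forall>x. e x = x)"
proof (rule ccontr)
  assume neg: "\<not> ?thesis"
  interpret e: additive e by standard (rule e_add)
  interpret \<alpha>: additive \<alpha> by standard (rule add)
  define N1 N2 where "N1 = {x. e x = x}" and "N2 = {x. e x = 0}"
  have img: "\<alpha> ` S = S" if "\<And>x. \<alpha> x \<in> S \<longleftrightarrow> x \<in> S" for S
    using that bij by (metis (no_types, lifting) bij_is_surj image_subsetI subsetI subset_antisym surjD image_eqI)
  have inj: "\<alpha> x = \<alpha> y \<longleftrightarrow> x = y" for x y
    using bij by (metis bij_pointE)
  have N1: "closed_submodule \<alpha> N1"
    unfolding closed_submodule_def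
  proof (intro conjI)
    show "closed N1" unfolding N1_def by (intro closed_Collect_eq cont continuous_intros)
    show "\<alpha> ` N1 = N1" by (rule img) (simp add: N1_def comm inj)
  qed (auto simp: N1_def e.zero e.add e.minus)
  have N2: "closed_submodule \<alpha> N2"
    unfolding closed_submodule_def
  proof (intro conjI)
    show "closed N2" unfolding N2_def by (intro closed_Collect_eq cont continuous_intros)
    show "\<alpha> ` N2 = N2" by (rule img) (use inj[of _ 0] in \<open>simp add: N2_def comm \<alpha>.zero\<close>)
  qed (auto simp: N2_def e.zero e.add e.minus)
  obtain x y where xy: "e x \<noteq> 0" "e y \<noteq> y" using neg by auto
  have "e x \<in> N1" "y - e y \<in> N2" by (auto simp: N1_def N2_def idem e.diff)
  then have ne: "N1 \<noteq> {0}" "N2 \<noteq> {0}" using xy by auto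
  have "homeomorphic_maps (prod_topology (subtopology euclidean N1) (subtopology euclidean N2))
            euclidean (\<lambda>(a, b). a + b) (\<lambda>x. (e x, x - e x))"
    unfolding homeomorphic_maps_def
  proof (intro conjI)
    have "continuous_on (N1 \<times> N2) (\<lambda>z. fst z + snd z)"
      by (intro continuous_intros)
    then have "continuous_map (subtopology euclidean (N1 \<times> N2)) euclidean (\<lambda>z. fst z + snd z)"
      by simp
    then show "continuous_map (prod_topology (subtopology euclidean N1) (subtopology euclidean N2))
        euclidean (\<lambda>(a, b). a + b)"
      by (simp only: prod_topology_subtopology_eu case_prod_unfold)
    have "continuous_on UNIV (\<lambda>x. x - e x)" by (intro continuous_intros cont)
    moreover have "e ` UNIV \<subseteq> N1" "(\<lambda>x. x - e x) ` UNIV \<subseteq> N2"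
      by (auto simp: N1_def N2_def idem e.diff)
    ultimately show "continuous_map euclidean (prod_topology (subtopology euclidean N1) (subtopology euclidean N2))
        (\<lambda>x. (e x, x - e x))"
      using cont by (auto simp: continuous_map_pairwise o_def continuous_map_in_subtopology intro!: continuous_on_Pair)
  qed (auto simp: N1_def N2_def e.add)
  then have "homeomorphic_map (prod_topology (subtopology euclidean N1) (subtopology euclidean N2))
            euclidean (\<lambda>(a, b). a + b)"
    using homeomorphic_maps_imp_map by blast
  then show False using indec N1 N2 ne unfolding indecomposable_def by blast
qed

section \<open>Neighbourhoods of 0 and uniform contraction on compact sets\<close>

lemma exists_diff_neighbourhood:
  fixes W :: "'a::topological_ab_group_add set"
  assumes "open W" "0 \<in> W"
  obtains V where "open V" "0 \<in> V" "\<And>x y. x \<in> V \<Longrightarrow> y \<in> V \<Longrightarrow> x - y \<in> W"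
proof -
  have "open ((\<lambda>z. fst z - snd z) -` W)"
    using assms(1) by (intro open_vimage continuous_intros)
  moreover have "(0, 0) \<in> (\<lambda>z. fst z - snd z) -` W" using assms(2) by simp
  ultimately obtain A B where "open A" "open B" "(0, 0) \<in> A \<times> B" "A \<times> B \<subseteq> (\<lambda>z. fst z - snd z) -` W"
    by (rule open_prod_elim)
  then show thesis by (intro that[of "A \<inter> B"]) auto
qed

lemma open_translation_vimage:
  fixes V :: "'a::topological_ab_group_add set"
  assumes "open V"
  shows "open {u. x + u \<in> V}" "open {u. u - x \<in> V}" "open {u. x - u \<in> V}"
proof -
  have "open ((\<lambda>u. x + u) -` V)" "open ((\<lambda>u. u - x) -` V)" "open ((\<lambda>u. x - u) -` V)"
    using assms by (intro open_vimage continuous_intros; simp)+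
  then show "open {u. x + u \<in> V}" "open {u. u - x \<in> V}" "open {u. x - u \<in> V}"
    by (simp_all add: vimage_def)
qed

lemma additive_funpow:
  fixes f :: "'a::ab_group_add \<Rightarrow> 'a"
  assumes "\<And>x y. f (x + y) = f x + f y"
  shows "(f ^^ n) (x + y) = (f ^^ n) x + (f ^^ n) y"
  by (induction n) (simp_all add: assms)

lemma continuous_on_funpow:
  fixes f :: "'a::topological_space \<Rightarrow> 'a"
  assumes "continuous_on UNIV f"
  shows "continuous_on UNIV (f ^^ n)"
proof (induction n)
  case (Suc n)
  have "continuous_on UNIV (f \<circ> (f ^^ n))"
    using Suc assms continuous_on_compose continuous_on_subset by blast
  then show ?case by simp
qed (simp add: id_def)

text \<open>A compact neighbourhood \<open>V\<close> of \<open>0\<close> satisfies \<open>V + V \<subseteq> V + F\<close> with \<open>F\<close> finite. As \<open>F\<close>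
  generates a finite group \<open>G\<close>, the set \<open>V + G\<close> is a compact open subgroup.\<close>
lemma exists_compact_open_subgroup:
  assumes lc: "locally_compact_space (euclidean :: 'a::{topological_ab_group_add, t2_space} topology)"
    and m: "m > 0" "\<And>x::'a::{topological_ab_group_add, t2_space}. m \<cdot> x = 0"
  obtains H :: "'a::{topological_ab_group_add, t2_space} set" where "subgroup H" "open H" "compact H"
proof -
  obtain U V where UV: "open (U :: 'a set)" "compact V" "0 \<in> U" "U \<subseteq> V"
    using lc unfolding locally_compact_space_def by (metis UNIV_I compactin_euclidean_iff open_openin topspace_euclidean)
  define S where "S = (\<lambda>z. fst z + snd z) ` (V \<times> V)"
  have "compact S"
    unfolding S_def by (intro compact_continuous_image compact_Times UV continuous_intros)
  moreover have "\<And>s. s \<in> S \<Longrightarrow> open {u. u - s \<in> U}" using UV(1) by (rule open_translation_vimage)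
  moreover have "S \<subseteq> (\<Union>s\<in>S. {u. u - s \<in> U})" using UV(3) by auto
  ultimately obtain F where F: "F \<subseteq> S" "finite F" "S \<subseteq> (\<Union>s\<in>F. {u. u - s \<in> U})"
    by (rule compactE_image)
  define G where "G = int_module.span F"
  have finG: "finite G" unfolding G_def using F(2) m by (rule finite_span_if_exponent)
  have G: "subgroup G" unfolding G_def by simp
  define H where "H = (\<Union>g\<in>G. (\<lambda>v. v + g) ` V)"
  have HI: "v + g \<in> H" if "v \<in> V" "g \<in> G" for v g using that by (auto simp: H_def)
  have "compact H" unfolding H_def using finG
    by (intro compact_UN compact_continuous_image UV continuous_intros)
  moreover have Hadd: "x + y \<in> H" if xy: "x \<in> H" "y \<in> H" for x y
  proof -
    obtain v g v' g' where v: "x = v + g" "y = v' + g'" "v \<in> V" "v' \<in> V" "g \<in> G" "g' \<in> G"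
      using xy by (auto simp: H_def)
    have "v + v' \<in> S"
      using v by (auto simp: S_def intro!: image_eqI[of _ _ "(v, v')"])
    then obtain f where f: "f \<in> F" "v + v' - f \<in> U" using F(3) by auto
    have "f \<in> G" unfolding G_def using f by (simp add: int_module.span_base)
    then have "f + (g + g') \<in> G" using G v by (simp add: int_module.subspace_add)
    moreover have "x + y = (v + v' - f) + (f + (g + g'))" using v by (simp add: algebra_simps)
    ultimately show ?thesis using HI f UV(4) by (metis subsetD)
  qed
  have UH: "U \<subseteq> H" using HI[of _ 0] UV(4) int_module.subspace_0[OF G] by auto
  have H: "subgroup H"
  proof (rule subgroupI)
    show H0: "0 \<in> H" using UH UV(3) by auto
    show "x + y \<in> H" if "x \<in> H" "y \<in> H" for x y using that by (rule Hadd)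
    show "- x \<in> H" if "x \<in> H" for x
    proof -
      \<comment> \<open>Exponent \<open>m\<close> turns \<open>- x\<close> into the sum of
        \<open>m - 1\<close> copies of \<open>x\<close>, so closure under addition suffices.\<close>
      have "nat_mult n x \<in> H" for n using H0 Hadd that by (induction n) auto
      from this[of "nat (m - 1)"] have "(m - 1) \<cdot> x \<in> H"
        using m(1) by (simp add: int_mult_of_nat[symmetric])
      moreover have "(m - 1) \<cdot> x = - x"
        using m(2)[of x] by (simp add: int_module.scale_left_diff_distrib)
      ultimately show ?thesis by simp
    qed
  qed
  moreover have "open H"
  proof (subst open_subopen, intro ballI)
    fix x assume x: "x \<in> H"
    have "{u. u - x \<in> U} \<subseteq> H"
    proof
      fix u assume "u \<in> {u. u - x \<in> U}"
      then have "u - x \<in> H" using UH by auto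
      from Hadd[OF this x] show "u \<in> H" by simp
    qed
    then show "\<exists>T. open T \<and> x \<in> T \<and> T \<subseteq> H"
      using open_translation_vimage(2)[OF UV(1), of x] UV(3) by (intro exI[of _ "{u. u - x \<in> U}"]) auto
  qed
  ultimately show thesis using that by blast
qed

text \<open>The closed sets \<open>A k\<close> of points whose orbit stays in
  \<open>closure V\<close> from time \<open>k\<close> on cover the group, so by Baire one of them
  has an interior point \<open>x\<close>; the orbit of a small \<open>u\<close> is the difference of
  the orbits of \<open>x + u\<close> and \<open>x\<close>.\<close>

lemma uniform_contraction_near_0:
  fixes \<alpha> :: "'a::{topological_ab_group_add, t2_space} \<Rightarrow> 'a"
  assumes lc: "locally_compact_space (euclidean :: 'a topology)"
    and cont: "continuous_on UNIV \<alpha>"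
    and add: "\<And>x y. \<alpha> (x + y) = \<alpha> x + \<alpha> y"
    and contr: "\<And>x. (\<lambda>n. (\<alpha> ^^ n) x) \<longlonglongrightarrow> 0"
    and W: "open W" "0 \<in> W"
  obtains V k where "open V" "0 \<in> V" "\<And>n x. n \<ge> k \<Longrightarrow> x \<in> V \<Longrightarrow> (\<alpha> ^^ n) x \<in> W"
proof -
  obtain V1 where V1: "open V1" "0 \<in> V1" "\<And>x y. x \<in> V1 \<Longrightarrow> y \<in> V1 \<Longrightarrow> x - y \<in> W"
    using exists_diff_neighbourhood[OF W] by blast
  obtain V where V: "open V" "0 \<in> V" "\<And>x y. x \<in> V \<Longrightarrow> y \<in> V \<Longrightarrow> x - y \<in> V1"
    using exists_diff_neighbourhood[OF V1(1,2)] by blast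
  \<comment> \<open>Baire needs closed sets, hence \<open>closure V\<close>; it lies in
    \<open>V - V\<close> and thus in \<open>V1\<close>.\<close>
  have clV: "x \<in> V1" if x: "x \<in> closure V" for x
  proof -
    have "open {u. u - x \<in> V}" "x \<in> {u. u - x \<in> V}"
      using open_translation_vimage(2)[OF V(1)] V(2) by auto
    then obtain u where "u \<in> V" "u - x \<in> V"
      using x unfolding closure_iff_nhds_not_empty by blast
    from V(3)[OF this] show ?thesis by simp
  qed
  define A where "A k = (\<Inter>n\<in>{k..}. (\<alpha> ^^ n) -` closure V)" for k
  have clA: "closed (A k)" for k
    unfolding A_def by (intro closed_INT ballI closed_vimage continuous_on_funpow cont) auto
  have "\<exists>k. x \<in> A k" for x
  proof -
    have "\<forall>\<^sub>F n in sequentially. (\<alpha> ^^ n) x \<in> V"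
      using topological_tendstoD[OF contr V(1,2)] .
    then obtain k where "\<forall>n\<ge>k. (\<alpha> ^^ n) x \<in> V" by (auto simp: eventually_sequentially)
    then have "x \<in> A k" using closure_subset[of V] by (auto simp: A_def)
    then show ?thesis ..
  qed
  then have "\<Union>(range A) = UNIV" by auto
  moreover have "Hausdorff_space (euclidean :: 'a topology)"
    unfolding Hausdorff_space_def disjnt_def using hausdorff by (metis open_openin)
  then have "regular_space (euclidean :: 'a topology)"
    using lc locally_compact_Hausdorff_imp_regular_space by blast
  ultimately have "\<not> (\<forall>S\<in>range A. closed S \<and> interior S = {})"
    using Baire_category_alt[of "euclidean :: 'a topology" "range A"] lc by auto
  then obtain k where "interior (A k) \<noteq> {}" using clA by blast
  then obtain x where x: "x \<in> interior (A k)" by auto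
  show thesis
  proof (rule that)
    show "open {u. x + u \<in> interior (A k)}" by (intro open_translation_vimage) simp
    show "0 \<in> {u. x + u \<in> interior (A k)}" using x by simp
    fix n u assume n: "n \<ge> k" and u: "u \<in> {u. x + u \<in> interior (A k)}"
    have "x + u \<in> A k" "x \<in> A k" using u x interior_subset by auto
    then have "(\<alpha> ^^ n) (x + u) \<in> V1" "(\<alpha> ^^ n) x \<in> V1" using n clV by (auto simp: A_def)
    from V1(3)[OF this] show "(\<alpha> ^^ n) u \<in> W" by (simp add: additive_funpow[of \<alpha>, OF add])
  qed
qed

text \<open>Finitely many sets \<open>y - X\<close> cover \<open>S\<close>. The centres
  \<open>y\<close> contract pointwise, the offsets \<open>y - x\<close> uniformly by the result near
  0, and \<open>x = y - (y - x)\<close>.\<close>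

lemma uniform_contraction_on_compact:
  fixes \<alpha> :: "'a::{topological_ab_group_add, t2_space} \<Rightarrow> 'a"
  assumes lc: "locally_compact_space (euclidean :: 'a topology)"
    and cont: "continuous_on UNIV \<alpha>"
    and add: "\<And>x y. \<alpha> (x + y) = \<alpha> x + \<alpha> y"
    and contr: "\<And>x. (\<lambda>n. (\<alpha> ^^ n) x) \<longlonglongrightarrow> 0"
    and S: "compact S" and W: "open W" "0 \<in> W"
  obtains k where "\<And>n x. n \<ge> k \<Longrightarrow> x \<in> S \<Longrightarrow> (\<alpha> ^^ n) x \<in> W"
proof -
  obtain V where V: "open V" "0 \<in> V" "\<And>x y. x \<in> V \<Longrightarrow> y \<in> V \<Longrightarrow> x - y \<in> W"
    using exists_diff_neighbourhood[OF W] by blast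
  obtain X k where X: "open X" "0 \<in> X" "\<And>n x. n \<ge> k \<Longrightarrow> x \<in> X \<Longrightarrow> (\<alpha> ^^ n) x \<in> V"
    using uniform_contraction_near_0[OF lc cont add contr V(1,2)] by blast
  have "S \<subseteq> (\<Union>y\<in>S. {s. y - s \<in> X})" using X(2) by auto
  then obtain F where F: "F \<subseteq> S" "finite F" "S \<subseteq> (\<Union>y\<in>F. {s. y - s \<in> X})"
    using compactE_image[OF S, of S "\<lambda>y. {s. y - s \<in> X}"] open_translation_vimage(3)[OF X(1)] by blast
  have "\<forall>\<^sub>F n in sequentially. \<forall>y\<in>F. (\<alpha> ^^ n) y \<in> V"
    using F(2) by (intro eventually_ball_finite ballI topological_tendstoD[OF contr V(1,2)])
  then obtain l where l: "\<And>n y. n \<ge> l \<Longrightarrow> y \<in> F \<Longrightarrow> (\<alpha> ^^ n) y \<in> V"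
    by (auto simp: eventually_sequentially)
  show thesis
  proof (rule that)
    fix n x assume n: "n \<ge> max k l" and x: "x \<in> S"
    obtain y where y: "y \<in> F" "y - x \<in> X" using F(3) x by auto
    have "(\<alpha> ^^ n) y \<in> V" "(\<alpha> ^^ n) (y - x) \<in> V" using n y X(3) l by auto
    from V(3)[OF this] show "(\<alpha> ^^ n) x \<in> W"
      using additive_funpow[of \<alpha> n x "y - x", OF add] by (simp add: algebra_simps)
  qed
qed

text \<open>\<open>K\<close> models the power series inside the Laurent series: its forward images
  shrink to 0 by \<open>small\<close>, its backward images exhaust the group by
  \<open>absorb\<close>.\<close>

locale contraction_lattice =
  fixes \<alpha> :: "'a::{topological_ab_group_add, t2_space} \<Rightarrow> 'a" and K :: "'a set"
  assumes bij: "bij \<alpha>" and add: "\<alpha> (x + y) = \<alpha> x + \<alpha> y"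
    and cont: "continuous_on UNIV \<alpha>" and cont_inv: "continuous_on UNIV (inv \<alpha>)"
    and K: "subgroup K" "open K" "compact K" and \<alpha>_K: "x \<in> K \<Longrightarrow> \<alpha> x \<in> K"
    and small: "open W \<Longrightarrow> 0 \<in> W \<Longrightarrow> \<exists>n. \<forall>x\<in>K. (\<alpha> ^^ n) x \<in> W"
    and absorb: "\<exists>n. (\<alpha> ^^ n) x \<in> K"

text \<open>A compact open subgroup \<open>H\<close> is only known to be mapped into itself by high
  powers of \<open>\<alpha>\<close>; the points whose whole forward orbit stays in \<open>H\<close>
  form an invariant subgroup.\<close>

lemma exists_contraction_lattice:
  fixes \<alpha> :: "'a::{topological_ab_group_add, t2_space} \<Rightarrow> 'a"
  assumes lc: "locally_compact_space (euclidean :: 'a topology)"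
    and hom: "homeomorphic_map euclidean euclidean \<alpha>"
    and add: "\<And>x y. \<alpha> (x + y) = \<alpha> x + \<alpha> y"
    and contr: "\<And>x. (\<lambda>n. (\<alpha> ^^ n) x) \<longlonglongrightarrow> 0"
    and m: "m > 0" "\<And>x::'a. m \<cdot> x = 0"
  obtains K where "contraction_lattice \<alpha> K"
proof -
  obtain \<beta> where \<beta>: "homeomorphic_maps euclidean euclidean \<alpha> \<beta>"
    using hom by (auto simp: homeomorphic_map_maps)
  then have ab: "\<And>x. \<beta> (\<alpha> x) = x" "\<And>x. \<alpha> (\<beta> x) = x"
    and cont: "continuous_on UNIV \<alpha>" "continuous_on UNIV \<beta>"
    by (auto simp: homeomorphic_maps_def)
  have bij: "bij \<alpha>" using ab by (metis bijI' )
  have inv: "inv \<alpha> = \<beta>" using ab by (metis inv_equality ext)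
  obtain H :: "'a set" where H: "subgroup H" "open H" "compact H"
    using exists_compact_open_subgroup[OF lc m] by blast
  have H0: "0 \<in> H" using H(1) by (rule int_module.subspace_0)
  obtain k where k: "\<And>n x. n \<ge> k \<Longrightarrow> x \<in> H \<Longrightarrow> (\<alpha> ^^ n) x \<in> H"
    using uniform_contraction_on_compact[OF lc cont(1) add contr H(3,2) H0] by blast
  define K where "K = (\<Inter>n. (\<alpha> ^^ n) -` H)"
  have KH: "K \<subseteq> H" unfolding K_def by (rule subsetI) (metis INT_D UNIV_I funpow_0 vimage_eq)
  \<comment> \<open>Powers from \<open>k\<close> on map \<open>H\<close> into itself, so finitely
    many conditions suffice and \<open>K\<close> is open.\<close>
  have "K = (\<Inter>n\<in>{..k}. (\<alpha> ^^ n) -` H)"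
  proof (intro equalityI subsetI)
    fix x assume x: "x \<in> (\<Inter>n\<in>{..k}. (\<alpha> ^^ n) -` H)"
    then have "x \<in> (\<alpha> ^^ 0) -` H" by blast
    then have "x \<in> H" by simp
    then have "(\<alpha> ^^ n) x \<in> H" for n using k x by (cases "n \<le> k") auto
    then show "x \<in> K" by (simp add: K_def)
  qed (auto simp: K_def)
  then have "open K" using H(2) by (auto intro!: open_INT open_vimage continuous_on_funpow cont)
  moreover have "closed K" unfolding K_def
    by (intro closed_INT ballI closed_vimage continuous_on_funpow cont compact_imp_closed H)
  then have "compact K" using H(3) KH by (metis compact_Int_closed inf.absorb2)
  moreover have "subgroup K"
  proof (rule subgroupI)
    interpret \<alpha>n: additive "\<alpha> ^^ n" for n by standard (rule additive_funpow[of \<alpha>, OF add])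
    show "0 \<in> K" using H0 by (simp add: K_def \<alpha>n.zero)
    show "x + y \<in> K" if "x \<in> K" "y \<in> K" for x y
      using that H(1) by (simp add: K_def \<alpha>n.add int_module.subspace_add)
    show "- x \<in> K" if "x \<in> K" for x
      using that H(1) by (simp add: K_def \<alpha>n.minus int_module.subspace_neg)
  qed
  moreover have "\<alpha> x \<in> K" if "x \<in> K" for x
  proof -
    have "(\<alpha> ^^ Suc n) x \<in> H" for n using that unfolding K_def by blast
    then show ?thesis by (simp add: K_def funpow_swap1)
  qed
  moreover have "\<exists>n. \<forall>x\<in>K. (\<alpha> ^^ n) x \<in> W" if "open W" "0 \<in> W" for W
    using uniform_contraction_on_compact[OF lc cont(1) add contr \<open>compact K\<close> that] by (metis order_refl)
  moreover have "\<exists>n. (\<alpha> ^^ n) x \<in> K" for x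
  proof -
    have "0 \<in> K" using \<open>subgroup K\<close> by (rule int_module.subspace_0)
    from topological_tendstoD[OF contr \<open>open K\<close> this, of x] show ?thesis
      by (auto simp: eventually_sequentially)
  qed
  ultimately have "contraction_lattice \<alpha> K"
    using bij cont add by unfold_locales (auto simp: inv)
  then show thesis by (rule that)
qed

section \<open>Integer powers of the contraction and the filtration \<open>U\<close>\<close>

context contraction_lattice
begin

definition T :: "int \<Rightarrow> 'a \<Rightarrow> 'a" where
  "T k x = (if k \<ge> 0 then (\<alpha> ^^ nat k) x else (inv \<alpha> ^^ nat (- k)) x)"

text \<open>This is the image of \<open>K\<close> under \<open>T i\<close>, the counterpart of the
  series of order at least \<open>i\<close>. The preimage form lets membership unfold
  directly.\<close>

definition U :: "int \<Rightarrow> 'a set" where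
  "U i = {x. T (- i) x \<in> K}"

lemma inv_\<alpha> [simp]: "inv \<alpha> (\<alpha> x) = x" "\<alpha> (inv \<alpha> x) = x"
  using bij by (simp_all add: bij_is_inj bij_is_surj surj_f_inv_f)

lemma inv_add: "inv \<alpha> (x + y) = inv \<alpha> x + inv \<alpha> y"
  by (metis add inv_\<alpha>)

lemma T_0 [simp]: "T 0 x = x"
  by (simp add: T_def)

lemma T_Suc: "T (k + 1) x = \<alpha> (T k x)"
proof (cases "k \<ge> 0")
  case True
  then have "nat (k + 1) = Suc (nat k)" by simp
  then show ?thesis using True by (simp add: T_def)
next
  case False
  then obtain n where "k = - int (Suc n)" by (metis nonneg_int_cases int_cases linorder_not_less negative_zless_0 of_nat_less_0_iff)
  then have "nat (- k) = Suc n" "nat (- (k + 1)) = n" "k + 1 \<ge> 0 \<Longrightarrow> n = 0" "k + 1 \<ge> 0 \<Longrightarrow> k = -1" by auto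
  then show ?thesis using False by (auto simp: T_def)
qed

lemma T_T [simp]: "T k (T l x) = T (k + l) x"
proof (induction k rule: int_induct[where k = 0])
  case (step1 i)
  then show ?case using T_Suc[of i "T l x"] T_Suc[of "i + l" x] by (simp add: algebra_simps)
next
  case (step2 i)
  have "\<alpha> (T (i - 1) (T l x)) = \<alpha> (T (i - 1 + l) x)"
    using step2 T_Suc[of "i - 1" "T l x"] T_Suc[of "i - 1 + l" x] by (simp add: algebra_simps)
  then show ?case by (metis inv_\<alpha>(1))
qed simp

lemma T_1: "T 1 x = \<alpha> x"
  using T_Suc[of 0 x] by simp

lemma T_add: "T k (x + y) = T k x + T k y"
  by (simp add: T_def additive_funpow[of \<alpha>, OF add] additive_funpow[of "inv \<alpha>", OF inv_add])

sublocale T: additive "T k" for k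
  by standard (rule T_add)

lemma T_int_mult: "T k (c \<cdot> x) = c \<cdot> T k x"
  by (rule int_mult_additive) (rule T_add)

lemma continuous_on_T: "continuous_on UNIV (T k)"
proof (cases "k \<ge> 0")
  case True
  then have "T k = \<alpha> ^^ nat k" by (auto simp: T_def)
  then show ?thesis using continuous_on_funpow[OF cont] by simp
next
  case False
  then have "T k = inv \<alpha> ^^ nat (- k)" by (auto simp: T_def)
  then show ?thesis using continuous_on_funpow[OF cont_inv] by simp
qed

lemma T_mem_U [simp]: "T k x \<in> U i \<longleftrightarrow> x \<in> U (i - k)"
  by (simp add: U_def algebra_simps)

lemma subgroup_U: "subgroup (U i)"
  using K(1) by (intro subgroupI)
    (auto simp: U_def T.zero T.add T.minus int_module.subspace_0 int_module.subspace_add int_module.subspace_neg)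

lemma open_U: "open (U i)"
proof -
  have "U i = T (- i) -` K" by (auto simp: U_def)
  then show ?thesis using K(2) continuous_on_T by (auto intro!: open_vimage)
qed

lemma compact_U: "compact (U i)"
proof -
  have "x \<in> T i ` K" if "T (- i) x \<in> K" for x
    using that by (intro image_eqI[of _ _ "T (- i) x"]) auto
  then have "U i = T i ` K" by (auto simp: U_def)
  then show ?thesis using K(3) continuous_on_T
    by (metis compact_continuous_image continuous_on_subset subset_UNIV)
qed

lemma U_antimono: "i \<le> j \<Longrightarrow> U j \<subseteq> U i"
proof (induction j rule: int_ge_induct)
  case (step j)
  have "U (j + 1) \<subseteq> U j"
  proof
    fix x assume "x \<in> U (j + 1)"
    then have "T (- j - 1) x \<in> K" by (simp add: U_def)
    then have "\<alpha> (T (- j - 1) x) \<in> K" by (rule \<alpha>_K)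
    then show "x \<in> U j" using T_Suc[of "- j - 1" x] by (simp add: U_def)
  qed
  then show ?case using step by blast
qed simp

lemma U_mono_mem: "x \<in> U j \<Longrightarrow> i \<le> j \<Longrightarrow> x \<in> U i"
  using U_antimono by blast

lemma U_small:
  assumes "open W" "0 \<in> W"
  shows "\<exists>i. U i \<subseteq> W"
proof -
  obtain n where n: "\<And>x. x \<in> K \<Longrightarrow> (\<alpha> ^^ n) x \<in> W" using small[OF assms] by blast
  have "x \<in> W" if "x \<in> U (int n)" for x
  proof -
    have "(\<alpha> ^^ n) (T (- int n) x) \<in> W" using that n by (simp add: U_def)
    moreover have "(\<alpha> ^^ n) (T (- int n) x) = T (int n) (T (- int n) x)" by (simp only: T_def) simp
    ultimately show ?thesis by simp
  qed
  then show ?thesis by blast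
qed

lemma U_absorb: "\<exists>i. x \<in> U i"
proof -
  obtain n where "(\<alpha> ^^ n) x \<in> K" using absorb by blast
  then have "x \<in> U (- int n)" by (simp add: U_def T_def)
  then show ?thesis ..
qed

lemma U_Inter:
  assumes "\<And>i. x \<in> U i"
  shows "x = 0"
proof (rule ccontr)
  assume "x \<noteq> 0"
  then obtain W where "open W" "0 \<in> W" "x \<notin> W" using t1_space[of 0 x] by auto
  then show False using U_small assms by blast
qed

text \<open>Translations reduce continuity of an additive map to continuity at 0, where the
  \<open>U i\<close> are a neighbourhood basis.\<close>

lemma continuous_on_if_U:
  assumes f: "\<And>x y. f (x + y) = f x + f y" and U: "\<And>i. \<exists>j. \<forall>x\<in>U j. f x \<in> U i"
  shows "continuous_on UNIV (f :: 'a \<Rightarrow> 'a)"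
proof -
  interpret f: additive f by standard (rule f)
  have "open (f -` W)" if W: "open W" for W
  proof (subst open_subopen, intro ballI)
    fix x assume "x \<in> f -` W"
    then have "open {u. f x + u \<in> W}" "0 \<in> {u. f x + u \<in> W}"
      using W by (simp_all add: open_translation_vimage)
    then obtain i where i: "U i \<subseteq> {u. f x + u \<in> W}" using U_small by blast
    obtain j where j: "\<And>x. x \<in> U j \<Longrightarrow> f x \<in> U i" using U by blast
    have "{y. y - x \<in> U j} \<subseteq> f -` W"
    proof
      fix y assume "y \<in> {y. y - x \<in> U j}"
      then have "f (y - x) \<in> U i" using j by simp
      then have "f x + f (y - x) \<in> W" using i by blast
      then show "y \<in> f -` W" by (simp add: f.diff)
    qed
    moreover have "x \<in> {y. y - x \<in> U j}" using subgroup_U by (simp add: int_module.subspace_0)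
    ultimately show "\<exists>T. open T \<and> x \<in> T \<and> T \<subseteq> f -` W"
      using open_translation_vimage(2)[OF open_U] by blast
  qed
  then show ?thesis by (simp add: continuous_on_open_vimage)
qed

text \<open>Finite intersection property in the compact \<open>U i\<close>. It turns solutions of
  all truncated problems into one exact solution, both for prescribed coefficients and for infinite
  sums.\<close>

lemma compact_nested_Inter:
  fixes F :: "int \<Rightarrow> 'a set"
  assumes cl: "\<And>N. closed (F N)" and mono: "\<And>M N. M \<le> N \<Longrightarrow> F N \<subseteq> F M"
    and ne: "\<And>N. F N \<inter> U i \<noteq> {}"
  shows "\<exists>x\<in>U i. \<forall>N. x \<in> F N"
proof -
  have "U i \<inter> \<Inter>(range F) \<noteq> {}"
  proof (rule compact_imp_fip[OF compact_U])
    show "closed t" if "t \<in> range F" for t using that cl by auto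
    fix G assume G: "finite G" "G \<subseteq> range F"
    then obtain I where I: "finite I" "G = F ` I" by (meson finite_subset_image)
    show "U i \<inter> \<Inter>G \<noteq> {}"
    proof (cases "I = {}")
      case False
      have "F (Max I) \<subseteq> F N" if "N \<in> I" for N using I(1) that by (intro mono Max_ge)
      then have "F (Max I) \<subseteq> \<Inter>G" using I(2) by blast
      then show ?thesis using ne[of "Max I"] by blast
    qed (use I ne in auto)
  qed
  then show ?thesis by blast
qed

end

subsection \<open>The coefficient homomorphism\<close>

text \<open>The predicate under \<open>topology\<close> unfolds once it is known to satisfy the
  axioms; for intersections the larger of two thresholds works.\<close>

lemma openin_laurent_top:
  "openin (laurent_top q) V \<longleftrightarrow>
     V \<subseteq> laurent q \<and> (\<forall>f\<in>V. \<exists>j. {g \<in> laurent q. \<forall>k<j. g k = f k} \<subseteq> V)"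
proof -
  let ?P = "\<lambda>U. U \<subseteq> laurent q \<and> (\<forall>f\<in>U. \<exists>j. {g \<in> laurent q. \<forall>k<j. g k = f k} \<subseteq> U)"
  have "istopology ?P"
    unfolding istopology_def
  proof (intro conjI allI impI)
    fix S T assume S: "?P S" and T: "?P T"
    show "S \<inter> T \<subseteq> laurent q" using S by blast
    show "\<forall>f\<in>S \<inter> T. \<exists>j. {g \<in> laurent q. \<forall>k<j. g k = f k} \<subseteq> S \<inter> T"
    proof
      fix f assume f: "f \<in> S \<inter> T"
      obtain i j where "{g \<in> laurent q. \<forall>k<i. g k = f k} \<subseteq> S" "{g \<in> laurent q. \<forall>k<j. g k = f k} \<subseteq> T"
        using f S T by blast
      then have "{g \<in> laurent q. \<forall>k<max i j. g k = f k} \<subseteq> S \<inter> T" by auto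
      then show "\<exists>j. {g \<in> laurent q. \<forall>k<j. g k = f k} \<subseteq> S \<inter> T" by blast
    qed
  next
    fix \<K> assume K: "\<forall>S\<in>\<K>. ?P S"
    show "\<Union>\<K> \<subseteq> laurent q" using K by blast
    show "\<forall>f\<in>\<Union>\<K>. \<exists>j. {g \<in> laurent q. \<forall>k<j. g k = f k} \<subseteq> \<Union>\<K>"
      using K by (meson Union_iff Union_upper subset_trans)
  qed
  then show ?thesis by (simp add: laurent_top_def)
qed

lemma topspace_laurent_top: "topspace (laurent_top q) = laurent q"
proof
  show "topspace (laurent_top q) \<subseteq> laurent q"
    unfolding topspace_def openin_laurent_top by blast
  have "openin (laurent_top q) (laurent q)" by (auto simp: openin_laurent_top)
  then show "laurent q \<subseteq> topspace (laurent_top q)" by (rule openin_subset)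
qed

text \<open>Values of \<open>\<psi>\<close> are least nonnegative residues, so \<open>\<psi>\<close>
  is a homomorphism to the integers modulo \<open>q\<close>. Vanishing on the open subgroup
  \<open>U j\<close> makes it continuous.\<close>

locale laurent_character = contraction_lattice +
  fixes p q :: int and n :: nat and \<psi> :: "'a \<Rightarrow> int" and x0 :: 'a and j :: int
  assumes p: "prime p" and q: "q = p ^ n" "n \<ge> 1" and expo: "q \<cdot> (x :: 'a) = 0"
    and \<psi>_nonneg: "0 \<le> \<psi> x" and \<psi>_less: "\<psi> x < q"
    and \<psi>_add: "\<psi> (x + y) = (\<psi> x + \<psi> y) mod q"
    and \<psi>_U: "x \<in> U j \<Longrightarrow> \<psi> x = 0" and \<psi>_x0: "\<psi> x0 = 1"
begin

text \<open>The minus sign makes \<open>\<alpha>\<close> raise indices by one, matching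
  multiplication by \<open>t\<close>.\<close>

definition lcoeff :: "'a \<Rightarrow> int \<Rightarrow> int" where
  "lcoeff x k = \<psi> (T (- k) x)"

lemma q_gt_1: "q > 1"
  using p q by (simp add: one_less_power prime_gt_1_int)

lemma lcoeff_nonneg: "0 \<le> lcoeff x k" and lcoeff_less: "lcoeff x k < q"
  by (simp_all add: lcoeff_def \<psi>_nonneg \<psi>_less)

lemma lcoeff_eq_if_cong: "[lcoeff x k = a] (mod q) \<Longrightarrow> 0 \<le> a \<Longrightarrow> a < q \<Longrightarrow> lcoeff x k = a"
  by (metis cong_less_imp_eq_int lcoeff_nonneg lcoeff_less)

lemma lcoeff_add: "lcoeff (x + y) k = (lcoeff x k + lcoeff y k) mod q"
  by (simp add: lcoeff_def T_add \<psi>_add)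

lemma lcoeff_T: "lcoeff (T l x) k = lcoeff x (k - l)"
  by (simp add: lcoeff_def algebra_simps)

text \<open>\<open>T (- k)\<close> carries \<open>U i\<close> to \<open>U (i - k)\<close>, which
  lies in \<open>U j\<close> as soon as \<open>j \<le> i - k\<close>. This bounds the support below
  and makes each coefficient continuous.\<close>

lemma lcoeff_U: "x \<in> U i \<Longrightarrow> j + k \<le> i \<Longrightarrow> lcoeff x k = 0"
  unfolding lcoeff_def by (rule \<psi>_U) (auto intro: U_mono_mem)

lemma lcoeff_0 [simp]: "lcoeff 0 k = 0"
  by (rule lcoeff_U[of _ "j + k"]) (auto simp: int_module.subspace_0[OF subgroup_U])

text \<open>Coefficients are normalised residues, so linearity over the integers survives only as a
  congruence.\<close>

lemma cong_lcoeff_int_mult: "[lcoeff (c \<cdot> x) k = c * lcoeff x k] (mod q)"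
proof (induction c rule: int_induct[where k = 0])
  case (step1 i)
  have "lcoeff ((i + 1) \<cdot> x) k = (lcoeff (i \<cdot> x) k + lcoeff x k) mod q"
    by (simp add: int_module.scale_left_distrib lcoeff_add)
  then have "[lcoeff ((i + 1) \<cdot> x) k = lcoeff (i \<cdot> x) k + lcoeff x k] (mod q)"
    by (simp add: cong_def)
  also have "[lcoeff (i \<cdot> x) k + lcoeff x k = i * lcoeff x k + lcoeff x k] (mod q)"
    using step1 by (intro cong_add cong_refl)
  finally show ?case by (simp add: distrib_right)
next
  case (step2 i)
  have "lcoeff ((i - 1) \<cdot> x + x) k = (lcoeff ((i - 1) \<cdot> x) k + lcoeff x k) mod q"
    by (rule lcoeff_add)
  moreover have "(i - 1) \<cdot> x + x = i \<cdot> x" by (simp add: int_module.scale_left_diff_distrib)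
  ultimately have "[lcoeff (i \<cdot> x) k = lcoeff ((i - 1) \<cdot> x) k + lcoeff x k] (mod q)"
    by (simp add: cong_def)
  then have "[lcoeff ((i - 1) \<cdot> x) k + lcoeff x k = i * lcoeff x k] (mod q)"
    using step2 cong_sym cong_trans by blast
  then have "[lcoeff ((i - 1) \<cdot> x) k + lcoeff x k - lcoeff x k = i * lcoeff x k - lcoeff x k] (mod q)"
    by (intro cong_diff cong_refl)
  then show ?case by (simp add: algebra_simps)
qed simp

lemma cong_lcoeff_add: "[lcoeff (x + y) k = lcoeff x k + lcoeff y k] (mod q)"
  by (simp add: lcoeff_add cong_def)

lemma cong_lcoeff_sum: "[lcoeff (\<Sum>l\<in>S. f l) k = (\<Sum>l\<in>S. lcoeff (f l) k)] (mod q)"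
proof (induction S rule: infinite_finite_induct)
  case (insert l S)
  then show ?case
    using cong_trans[OF cong_lcoeff_add[of "f l" "sum f S" k]] by (simp add: cong_add)
qed auto

lemma lcoeff_eq_if_diff_eq_0:
  assumes "lcoeff (y - x) k = 0"
  shows "lcoeff y k = lcoeff x k"
proof -
  have "lcoeff y k = lcoeff x k mod q" using lcoeff_add[of "y - x" x k] assms by simp
  then show ?thesis using lcoeff_nonneg lcoeff_less by simp
qed

lemma lcoeff_diff_eq_0_if_eq:
  assumes "lcoeff y k = lcoeff x k"
  shows "lcoeff (y - x) k = 0"
proof -
  have "[lcoeff (y - x) k + lcoeff x k = 0 + lcoeff x k] (mod q)"
    using cong_lcoeff_add[of "y - x" x k] assms by (simp add: cong_sym)
  then have "[lcoeff (y - x) k = 0] (mod q)" by (simp only: cong_add_rcancel)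
  then show ?thesis using q_gt_1 by (intro lcoeff_eq_if_cong) auto
qed

lemma lcoeff_eventually_0: obtains k0 where "\<And>k. k < k0 \<Longrightarrow> lcoeff x k = 0"
proof -
  obtain i where "x \<in> U i" using U_absorb by blast
  then show thesis by (intro that[of "i - j"] lcoeff_U[of x i]) auto
qed

lemma lcoeff_laurent: "lcoeff x \<in> laurent q"
proof -
  obtain k0 where "\<And>k. k < k0 \<Longrightarrow> lcoeff x k = 0" using lcoeff_eventually_0[of x] by blast
  then show ?thesis using lcoeff_nonneg lcoeff_less by (auto simp: laurent_def)
qed

text \<open>Coefficient \<open>k\<close> is constant on cosets of the open subgroup
  \<open>U (j + k)\<close>, so any condition on a single coefficient is open and, by passing to
  complements, closed.\<close>

lemma open_lcoeff: "open {x. P (lcoeff x k)}"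
proof (subst open_subopen, intro ballI)
  fix x assume x: "x \<in> {x. P (lcoeff x k)}"
  have "lcoeff y k = lcoeff x k" if "y - x \<in> U (j + k)" for y
    using that by (intro lcoeff_eq_if_diff_eq_0 lcoeff_U) auto
  then have "{y. y - x \<in> U (j + k)} \<subseteq> {x. P (lcoeff x k)}" using x by auto
  moreover have "x \<in> {y. y - x \<in> U (j + k)}" using subgroup_U by (simp add: int_module.subspace_0)
  ultimately show "\<exists>T. open T \<and> x \<in> T \<and> T \<subseteq> {x. P (lcoeff x k)}"
    using open_translation_vimage(2)[OF open_U] by blast
qed

lemma closed_lcoeff: "closed {x. P (lcoeff x k)}"
  unfolding closed_def Collect_neg_eq[symmetric] by (rule open_lcoeff)

text \<open>Modulo \<open>p\<close> the series of a suitable \<open>z = T (- d) x0\<close> starts at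
  index 0 with a unit. Multiples of \<open>T N z\<close> then adjust coefficient \<open>N\<close>
  without disturbing earlier ones, and compactness supplies the limit.\<close>

lemma exists_lcoeff_cong_p:
  assumes f: "\<And>k. k < k0 \<Longrightarrow> f k = 0"
  shows "\<exists>x. \<forall>k. [lcoeff x k = f k] (mod p)"
proof -
  obtain k1 where k1: "\<And>k. k < k1 \<Longrightarrow> lcoeff x0 k = 0" using lcoeff_eventually_0[of x0] by blast
  have c00: "lcoeff x0 0 = 1" by (simp add: lcoeff_def \<psi>_x0)
  \<comment> \<open>The coefficients of \<open>x0\<close> vanish below \<open>k1\<close>, so the
    first index with a coefficient prime to \<open>p\<close> is \<open>k1\<close> plus a least
    natural number; one exists because coefficient 0 is 1.\<close>
  define Q where "Q m \<longleftrightarrow> \<not> p dvd lcoeff x0 (k1 + int m)" for m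
  have "k1 \<le> 0" using k1[of 0] c00 by fastforce
  then have "Q (nat (- k1))" using c00 p by (auto simp: Q_def not_prime_unit)
  then have Q: "Q (LEAST m. Q m)" "\<And>m. m < (LEAST m. Q m) \<Longrightarrow> \<not> Q m"
    by (auto intro: LeastI dest: not_less_Least)
  define d where "d = k1 + int (LEAST m. Q m)"
  define z where "z = T (- d) x0"
  have lcoeff_z: "lcoeff z k = lcoeff x0 (k + d)" for k by (simp add: z_def lcoeff_T)
  have z0: "\<not> p dvd lcoeff z 0" using Q(1) by (simp add: Q_def lcoeff_z d_def)
  have zneg: "p dvd lcoeff z k" if "k < 0" for k
  proof (cases "k + d < k1")
    case True
    then show ?thesis using k1 by (simp add: lcoeff_z)
  next
    case False
    then have "k + d = k1 + int (nat (k + d - k1))" "nat (k + d - k1) < (LEAST m. Q m)"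
      using that by (auto simp: d_def)
    then show ?thesis using Q(2) unfolding lcoeff_z Q_def by metis
  qed
  obtain c where c: "z \<in> U c" using U_absorb by blast
  have pq: "p dvd q" using q by (simp add: dvd_power)
  have cong_p: "[a = b] (mod p)" if "[a = b] (mod q)" for a b
    using that pq by (rule cong_dvd_modulus)
  define F where "F N = {x. \<forall>k<N. [lcoeff x k = f k] (mod p)}" for N
  \<comment> \<open>All approximations stay in the one compact set \<open>U (k0 + c)\<close>, since
    \<open>T N z\<close> lies in \<open>U (N + c)\<close> and \<open>N \<ge> k0\<close>.\<close>
  have step: "F N \<inter> U (k0 + c) \<noteq> {}" if "N \<ge> k0" for N
    using that
  proof (induction N rule: int_ge_induct)
    case base
    have "0 \<in> F k0 \<inter> U (k0 + c)" using f int_module.subspace_0[OF subgroup_U] by (auto simp: F_def)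
    then show ?case by blast
  next
    case (step N)
    then obtain x where x: "x \<in> U (k0 + c)" "\<And>k. k < N \<Longrightarrow> [lcoeff x k = f k] (mod p)"
      by (auto simp: F_def)
    have "coprime (lcoeff z 0) p" using z0 p by (metis coprime_commute prime_imp_coprime)
    then obtain b where b: "[lcoeff z 0 * b = f N - lcoeff x N] (mod p)"
      by (metis cong_solve_coprime_int cong_scalar_right mult.assoc mult_1)
    define x' where "x' = x + b \<cdot> T N z"
    have x': "[lcoeff x' k = lcoeff x k + b * lcoeff z (k - N)] (mod p)" for k
    proof (rule cong_p)
      have "[lcoeff x k + lcoeff (b \<cdot> T N z) k = lcoeff x k + b * lcoeff (T N z) k] (mod q)"
        by (intro cong_add cong_refl cong_lcoeff_int_mult)
      then show "[lcoeff x' k = lcoeff x k + b * lcoeff z (k - N)] (mod q)"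
        unfolding x'_def using cong_lcoeff_add cong_trans by (metis lcoeff_T)
    qed
    have "[lcoeff x' k = f k] (mod p)" if "k < N + 1" for k
    proof (cases "k = N")
      case True
      have "[lcoeff x N + b * lcoeff z 0 = lcoeff x N + (f N - lcoeff x N)] (mod p)"
        using b by (intro cong_add cong_refl) (simp add: mult.commute)
      then show ?thesis using x'[of N] True cong_trans by fastforce
    next
      case False
      then have "k < N" using that by simp
      then have "[lcoeff x k + b * lcoeff z (k - N) = f k + 0] (mod p)"
        using zneg[of "k - N"] x(2) by (intro cong_add) (auto simp: cong_0_iff)
      then show ?thesis using x'[of k] cong_trans by fastforce
    qed
    moreover have "x' \<in> U (k0 + c)"
    proof -
      have "T N z \<in> U (k0 + c)" using c step(1) by (auto intro: U_mono_mem)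
      then show ?thesis unfolding x'_def
        using x(1) subgroup_U by (simp add: int_module.subspace_add int_module.subspace_scale)
    qed
    ultimately show ?case by (auto simp: F_def)
  qed
  have "\<exists>x\<in>U (k0 + c). \<forall>N. x \<in> F N"
  proof (rule compact_nested_Inter)
    fix N
    have "F N = (\<Inter>k\<in>{..<N}. {x. [lcoeff x k = f k] (mod p)})" by (auto simp: F_def)
    then show "closed (F N)" by (auto intro!: closed_INT closed_lcoeff)
    show "F N \<inter> U (k0 + c) \<noteq> {}"
    proof (cases "N \<ge> k0")
      case False
      then have "F k0 \<subseteq> F N" by (auto simp: F_def)
      then show ?thesis using step[of k0] by auto
    qed (rule step)
  qed (auto simp: F_def)
  then obtain x where x: "\<And>N. x \<in> F N" by blast
  have "[lcoeff x k = f k] (mod p)" for k using x[of "k + 1"] by (simp add: F_def)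
  then show ?thesis by blast
qed

text \<open>Induction on the power of \<open>p\<close>, as in Hensel lifting: the error at stage
  \<open>i\<close> is \<open>p ^ i * h\<close>, and an element with coefficients \<open>h\<close>
  modulo \<open>p\<close> corrects it to the next power.\<close>

lemma exists_lcoeff_eq:
  assumes f: "f \<in> laurent q"
  obtains x where "lcoeff x = f"
proof -
  obtain k0 where k0: "\<And>k. k < k0 \<Longrightarrow> f k = 0" using f by (auto simp: laurent_def)
  have "i \<le> n \<Longrightarrow> \<exists>x. \<forall>k. [lcoeff x k = f k] (mod p ^ i)" for i
  proof (induction i)
    case (Suc i)
    then obtain x where x: "\<And>k. [lcoeff x k = f k] (mod p ^ i)" by auto
    have "\<forall>k. \<exists>h. f k = lcoeff x k + p ^ i * h"
      using x by (simp add: cong_iff_lin)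
    then obtain h where h: "\<And>k. f k = lcoeff x k + p ^ i * h k" by metis
    have pi: "p ^ i \<noteq> 0" using p by auto
    obtain k1 where k1: "\<And>k. k < k1 \<Longrightarrow> lcoeff x k = 0" using lcoeff_eventually_0[of x] by blast
    \<comment> \<open>Solvability modulo \<open>p\<close> requires a lower bound on the support of
      \<open>h\<close>; it comes from \<open>f\<close> and \<open>x\<close> after cancelling
      \<open>p ^ i\<close>.\<close>
    have "h k = 0" if "k < min k0 k1" for k using h[of k] k0[of k] k1[of k] that pi by auto
    then obtain x' where x': "\<And>k. [lcoeff x' k = h k] (mod p)"
      using exists_lcoeff_cong_p by blast
    have "[lcoeff (x + p ^ i \<cdot> x') k = f k] (mod p ^ Suc i)" for k
    proof -
      have "[lcoeff (x + p ^ i \<cdot> x') k = lcoeff x k + lcoeff (p ^ i \<cdot> x') k] (mod q)"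
        by (rule cong_lcoeff_add)
      also have "[lcoeff x k + lcoeff (p ^ i \<cdot> x') k = lcoeff x k + p ^ i * lcoeff x' k] (mod q)"
        by (intro cong_add cong_refl cong_lcoeff_int_mult)
      finally have "[lcoeff (x + p ^ i \<cdot> x') k = lcoeff x k + p ^ i * lcoeff x' k] (mod p ^ Suc i)"
        using Suc.prems q by (meson cong_dvd_modulus le_imp_power_dvd)
      also have "[p ^ i * lcoeff x' k = p ^ i * h k] (mod p ^ Suc i)"
        using x'[of k] pi by (simp add: cong_iff_dvd_diff right_diff_distrib[symmetric] mult.commute[of p])
      then have "[lcoeff x k + p ^ i * lcoeff x' k = f k] (mod p ^ Suc i)"
        unfolding h by (intro cong_add cong_refl)
      finally show ?thesis .
    qed
    then show ?case by blast
  qed auto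
  then obtain x where x: "\<And>k. [lcoeff x k = f k] (mod q)" using q by auto
  have "lcoeff x = f"
  proof
    show "lcoeff x k = f k" for k using x f by (intro lcoeff_eq_if_cong) (auto simp: laurent_def)
  qed
  then show thesis by (rule that)
qed

end

subsection \<open>The idempotent\<close>

text \<open>\<open>y\<close> is a preimage of the constant series 1, so the \<open>T k y\<close>
  play the role of the monomials \<open>t^k\<close>; \<open>c\<close> locates \<open>y\<close> in
  the filtration for the estimates of tails.\<close>

locale laurent_section = laurent_character +
  fixes y :: 'a and c :: int
  assumes lcoeff_y: "lcoeff y k = (if k = 0 then 1 else 0)" and y_U: "y \<in> U c"
begin

text \<open>Truncation below \<open>N\<close> of the series in the \<open>T k y\<close>. Summing
  over the support avoids fixing a lower bound, which \<open>partial_eq\<close> reintroduces when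
  convenient.\<close>

definition partial :: "int \<Rightarrow> 'a \<Rightarrow> 'a" where
  "partial N x = (\<Sum>k\<in>{k. k < N \<and> lcoeff x k \<noteq> 0}. lcoeff x k \<cdot> T k y)"

lemma finite_support: "finite {k. k < N \<and> lcoeff x k \<noteq> 0}"
proof -
  obtain k0 where "\<And>k. k < k0 \<Longrightarrow> lcoeff x k = 0" using lcoeff_eventually_0[of x] by blast
  then have "{k. k < N \<and> lcoeff x k \<noteq> 0} \<subseteq> {k0..<N}" by force
  then show ?thesis by (rule finite_subset) simp
qed

lemma partial_eq:
  assumes "\<And>k. k < k0 \<Longrightarrow> lcoeff x k = 0"
  shows "partial N x = (\<Sum>k\<in>{k0..<N}. lcoeff x k \<cdot> T k y)"
  unfolding partial_def by (rule sum.mono_neutral_left) (use assms in force)+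

lemma partial_add: "partial N (x + z) = partial N x + partial N z"
proof -
  obtain k1 where k1: "\<And>k. k < k1 \<Longrightarrow> lcoeff x k = 0" using lcoeff_eventually_0[of x] by blast
  obtain k2 where k2: "\<And>k. k < k2 \<Longrightarrow> lcoeff z k = 0" using lcoeff_eventually_0[of z] by blast
  define k0 where "k0 = min k1 k2"
  have 0: "lcoeff x k = 0" "lcoeff z k = 0" "lcoeff (x + z) k = 0" if "k < k0" for k
    using that k1 k2 by (simp_all add: k0_def lcoeff_add)
  \<comment> \<open>Coefficients add only modulo \<open>q\<close>, which is harmless because
    \<open>q\<close> annihilates the group.\<close>
  have "lcoeff (x + z) k \<cdot> T k y = lcoeff x k \<cdot> T k y + lcoeff z k \<cdot> T k y" for k
    using int_mult_eq_if_cong[OF expo cong_lcoeff_add[of x z k], of "T k y"]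
    by (simp add: int_module.scale_left_distrib)
  then show ?thesis by (simp add: partial_eq[of k0, OF 0(1)] partial_eq[of k0, OF 0(2)]
      partial_eq[of k0, OF 0(3)] sum.distrib)
qed

lemma partial_\<alpha>: "partial N (\<alpha> x) = \<alpha> (partial (N - 1) x)"
proof -
  obtain k0 where k0: "\<And>k. k < k0 \<Longrightarrow> lcoeff x k = 0" using lcoeff_eventually_0[of x] by blast
  have \<alpha>: "lcoeff (\<alpha> x) k = lcoeff x (k - 1)" for k using lcoeff_T[of 1 x k] by (simp add: T_1)
  have "partial N (\<alpha> x) = (\<Sum>k\<in>{k0 + 1..<N}. lcoeff x (k - 1) \<cdot> T k y)"
    using k0 by (simp add: partial_eq[of "k0 + 1"] \<alpha>)
  also have "\<dots> = (\<Sum>k\<in>{k0..<N - 1}. lcoeff x k \<cdot> T (1 + k) y)"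
    by (rule sum.reindex_bij_witness[of _ "\<lambda>k. k + 1" "\<lambda>k. k - 1"]) auto
  also have "\<dots> = T 1 (partial (N - 1) x)"
    using k0 by (simp add: partial_eq[of k0] T.sum T_int_mult)
  finally show ?thesis by (simp add: T_1)
qed

lemma term_U: "i \<le> k \<Longrightarrow> a \<cdot> T k y \<in> U (i + c)"
  using y_U by (intro int_module.subspace_scale subgroup_U) (auto intro: U_mono_mem)

lemma partial_U:
  assumes "\<And>k. k < i \<Longrightarrow> lcoeff x k = 0"
  shows "partial N x \<in> U (i + c)"
proof -
  have "partial N x = (\<Sum>k\<in>{i..<N}. lcoeff x k \<cdot> T k y)" using assms by (rule partial_eq)
  also have "\<dots> \<in> U (i + c)" by (intro int_module.subspace_sum subgroup_U term_U) auto
  finally show ?thesis .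
qed

text \<open>Cauchy estimate: only terms with index at least \<open>M\<close> remain, and each of
  them lies in \<open>U (M + c)\<close>.\<close>

lemma partial_diff_U:
  assumes "M \<le> N"
  shows "partial N x - partial M x \<in> U (M + c)"
proof -
  have "partial N x - partial M x =
      (\<Sum>k\<in>{k. k < N \<and> lcoeff x k \<noteq> 0} - {k. k < M \<and> lcoeff x k \<noteq> 0}. lcoeff x k \<cdot> T k y)"
    unfolding partial_def using assms finite_support by (subst sum_diff) auto
  also have "\<dots> \<in> U (M + c)" by (intro int_module.subspace_sum subgroup_U term_U) auto
  finally show ?thesis .
qed

text \<open>\<open>T l y\<close> has coefficient 1 at \<open>l\<close> and 0 elsewhere, so only the
  summand \<open>l = k\<close> survives.\<close>

lemma lcoeff_partial:
  assumes "k < N"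
  shows "lcoeff (partial N x) k = lcoeff x k"
proof (rule lcoeff_eq_if_cong)
  let ?S = "{k. k < N \<and> lcoeff x k \<noteq> 0}"
  have "[lcoeff (partial N x) k = (\<Sum>l\<in>?S. lcoeff (lcoeff x l \<cdot> T l y) k)] (mod q)"
    unfolding partial_def by (rule cong_lcoeff_sum)
  also have "[(\<Sum>l\<in>?S. lcoeff (lcoeff x l \<cdot> T l y) k) = (\<Sum>l\<in>?S. lcoeff x l * lcoeff (T l y) k)] (mod q)"
    by (intro cong_sum cong_lcoeff_int_mult)
  also have "(\<Sum>l\<in>?S. lcoeff x l * lcoeff (T l y) k) = (\<Sum>l\<in>?S. if k = l then lcoeff x l else 0)"
    by (intro sum.cong) (auto simp: lcoeff_T lcoeff_y)
  also have "\<dots> = lcoeff x k" using assms finite_support by simp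
  finally show "[lcoeff (partial N x) k = lcoeff x k] (mod q)" .
qed (rule lcoeff_nonneg lcoeff_less)+

text \<open>The infinite sum of the series, described by its rate of convergence instead of a limit
  operator.\<close>

definition proj :: "'a \<Rightarrow> 'a" where
  "proj x = (SOME z. \<forall>N. z - partial N x \<in> U (N + c))"

lemma proj: "proj x - partial N x \<in> U (N + c)"
proof -
  obtain k0 where k0: "\<And>k. k < k0 \<Longrightarrow> lcoeff x k = 0" using lcoeff_eventually_0[of x] by blast
  \<comment> \<open>All truncations lie in the compact \<open>U (k0 + c)\<close>, the conditions are
    nested by the Cauchy estimate, and \<open>partial N x\<close> itself satisfies the one for
    \<open>N\<close>.\<close>
  have "\<exists>z\<in>U (k0 + c). \<forall>N. z \<in> {z. z - partial N x \<in> U (N + c)}"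
  proof (rule compact_nested_Inter)
    fix N
    have "closed ((\<lambda>z. z - partial N x) -` U (N + c))"
      by (intro closed_vimage compact_imp_closed compact_U continuous_intros)
    then show "closed {z. z - partial N x \<in> U (N + c)}" by (simp add: vimage_def)
    have "partial N x \<in> {z. z - partial N x \<in> U (N + c)} \<inter> U (k0 + c)"
      using partial_U[OF k0] subgroup_U by (simp add: int_module.subspace_0)
    then show "{z. z - partial N x \<in> U (N + c)} \<inter> U (k0 + c) \<noteq> {}" by blast
  next
    fix M N :: int assume MN: "M \<le> N"
    show "{z. z - partial N x \<in> U (N + c)} \<subseteq> {z. z - partial M x \<in> U (M + c)}"
    proof safe
      fix z assume "z - partial N x \<in> U (N + c)"
      then have "z - partial N x \<in> U (M + c)" using MN by (auto intro: U_mono_mem)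
      from int_module.subspace_add[OF subgroup_U this partial_diff_U[OF MN, of x]]
      show "z - partial M x \<in> U (M + c)" by simp
    qed
  qed
  then have "\<exists>z. \<forall>N. z - partial N x \<in> U (N + c)" by blast
  from someI_ex[OF this] show ?thesis by (simp add: proj_def)
qed

text \<open>Two candidates differ by an element of every \<open>U i\<close>, hence by 0. Additivity
  and equivariance of \<open>proj\<close> follow by checking the defining estimate.\<close>

lemma proj_eqI:
  assumes "\<And>N. z - partial N x \<in> U (N + c)"
  shows "proj x = z"
proof -
  have "proj x - z \<in> U i" for i
    using int_module.subspace_diff[OF subgroup_U proj[of x "i - c"] assms[of "i - c"]] by simp
  then have "proj x - z = 0" by (rule U_Inter)
  then show ?thesis by simp
qed

lemma proj_add: "proj (x + z) = proj x + proj z"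
proof (rule proj_eqI)
  show "proj x + proj z - partial N (x + z) \<in> U (N + c)" for N
    using int_module.subspace_add[OF subgroup_U proj proj, of x N z] by (simp add: partial_add algebra_simps)
qed

lemma proj_\<alpha>: "proj (\<alpha> x) = \<alpha> (proj x)"
proof (rule proj_eqI)
  fix N
  interpret \<alpha>: additive \<alpha> by standard (rule add)
  have "T 1 (proj x - partial (N - 1) x) \<in> U (N + c)"
    using proj[of x "N - 1"] by (simp add: algebra_simps)
  then show "\<alpha> (proj x) - partial N (\<alpha> x) \<in> U (N + c)" by (simp add: T_1 \<alpha>.diff partial_\<alpha>)
qed

text \<open>Both the truncation at \<open>i\<close> and the remainder lie in
  \<open>U (i + c)\<close>. The estimate gives continuity of \<open>proj\<close> and later openness
  of \<open>lcoeff\<close>.\<close>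

lemma proj_U:
  assumes "\<And>k. k < i \<Longrightarrow> lcoeff x k = 0"
  shows "proj x \<in> U (i + c)"
  using int_module.subspace_add[OF subgroup_U proj[of x i] partial_U[OF assms, where N = i]] by simp

lemma lcoeff_proj: "lcoeff (proj x) k = lcoeff x k"
proof -
  \<comment> \<open>The first bound includes index \<open>k\<close> in the truncation, the second
    puts the remainder deep enough for its coefficient \<open>k\<close> to vanish.\<close>
  define N where "N = max (k + 1) (j + k - c)"
  have "lcoeff (proj x - partial N x) k = 0"
    by (rule lcoeff_U[OF proj]) (simp add: N_def)
  then have "lcoeff (proj x) k = lcoeff (partial N x) k" by (rule lcoeff_eq_if_diff_eq_0)
  also have "\<dots> = lcoeff x k" by (rule lcoeff_partial) (simp add: N_def)
  finally show ?thesis .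
qed

text \<open>Only coefficients enter the construction. As \<open>proj\<close> preserves them, it is
  idempotent; once it is the identity, coefficients determine the element.\<close>

lemma proj_cong: "lcoeff x = lcoeff z \<Longrightarrow> proj x = proj z"
  by (simp add: proj_def partial_def)

lemma proj_proj: "proj (proj x) = proj x"
  by (rule proj_cong) (auto simp: lcoeff_proj)

lemma continuous_on_proj: "continuous_on UNIV proj"
proof (rule continuous_on_if_U[OF proj_add])
  fix i
  have "proj x \<in> U i" if "x \<in> U (j + (i - c))" for x
    using proj_U[of "i - c" x] lcoeff_U[OF that] by simp
  then show "\<exists>j. \<forall>x\<in>U j. proj x \<in> U i" by blast
qed

text \<open>Coefficient 0 of \<open>proj y\<close> is 1, so the idempotent is not zero, and
  indecomposability leaves only the identity.\<close>

lemma proj_eq_self: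
  assumes "indecomposable \<alpha>"
  shows "proj x = x"
proof -
  have "lcoeff (proj y) 0 \<noteq> 0" by (simp add: lcoeff_proj lcoeff_y)
  then have "proj y \<noteq> 0" by (metis lcoeff_0)
  then show ?thesis
    using indecomposable_imp_trivial_idempotent[OF assms bij add proj_add continuous_on_proj proj_proj proj_\<alpha>]
    by blast
qed

lemma homeomorphic_map_lcoeff:
  assumes "indecomposable \<alpha>"
  shows "inj lcoeff" "homeomorphic_map euclidean (laurent_top q) lcoeff"
proof -
  note id = proj_eq_self[OF assms]
  show inj: "inj lcoeff" by (rule injI) (metis proj_cong id)
  have surj: "range lcoeff = laurent q" using lcoeff_laurent exists_lcoeff_eq by blast
  show "homeomorphic_map euclidean (laurent_top q) lcoeff"
  proof (rule bijective_open_imp_homeomorphic_map)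
    show "lcoeff ` topspace euclidean = topspace (laurent_top q)"
      by (simp add: surj topspace_laurent_top)
    show "inj_on lcoeff (topspace euclidean)" using inj by simp
    have "open (lcoeff -` V)" if V: "openin (laurent_top q) V" for V
    proof (subst open_subopen, intro ballI)
      fix x assume "x \<in> lcoeff -` V"
      then obtain i where i: "{g \<in> laurent q. \<forall>k<i. g k = lcoeff x k} \<subseteq> V"
        using V by (auto simp: openin_laurent_top)
      have "z \<in> lcoeff -` V" if z: "z - x \<in> U (j + i)" for z
      proof -
        have "\<forall>k<i. lcoeff z k = lcoeff x k"
          by (auto intro!: lcoeff_eq_if_diff_eq_0 lcoeff_U[OF z])
        then show ?thesis using i lcoeff_laurent by blast
      qed
      then have "{z. z - x \<in> U (j + i)} \<subseteq> lcoeff -` V" by blast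
      moreover have "x \<in> {z. z - x \<in> U (j + i)}" using subgroup_U by (simp add: int_module.subspace_0)
      ultimately show "\<exists>T. open T \<and> x \<in> T \<and> T \<subseteq> lcoeff -` V"
        using open_translation_vimage(2)[OF open_U] by blast
    qed
    then show "continuous_map euclidean (laurent_top q) lcoeff"
      by (auto simp: continuous_map_def topspace_laurent_top lcoeff_laurent vimage_def)
    have "openin (laurent_top q) (lcoeff ` S)" if S: "open S" for S
      unfolding openin_laurent_top
    proof (intro conjI ballI)
      show "lcoeff ` S \<subseteq> laurent q" using lcoeff_laurent by auto
      fix f assume "f \<in> lcoeff ` S"
      then obtain x where x: "x \<in> S" "f = lcoeff x" by auto
      have "open {u. x + u \<in> S}" "0 \<in> {u. x + u \<in> S}"
        using open_translation_vimage(1)[OF S] x by auto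
      then obtain i where i: "U i \<subseteq> {u. x + u \<in> S}" using U_small by blast
      have "g \<in> lcoeff ` S" if g: "g \<in> laurent q" "\<And>k. k < i - c \<Longrightarrow> g k = f k" for g
      proof -
        obtain z where z: "lcoeff z = g" using exists_lcoeff_eq[OF g(1)] by blast
        \<comment> \<open>Coefficients of \<open>z - x\<close> vanish below \<open>i - c\<close>, so
          \<open>proj (z - x)\<close>, which equals \<open>z - x\<close>, lies in
          \<open>U i\<close>.\<close>
        have "proj (z - x) \<in> U (i - c + c)"
          by (rule proj_U, rule lcoeff_diff_eq_0_if_eq) (simp add: z g(2) x(2))
        then have "x + (z - x) \<in> S" using i id by auto
        then show ?thesis using z by auto
      qed
      then show "\<exists>j. {g \<in> laurent q. \<forall>k<j. g k = f k} \<subseteq> lcoeff ` S" by blast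
    qed
    then show "open_map euclidean (laurent_top q) lcoeff" by (simp add: open_map_def)
  qed
qed

end

section \<open>Reduction to prime power exponent\<close>

text \<open>Write the least exponent as \<open>d = p ^ s * b\<close> with \<open>p\<close> not
  dividing \<open>b\<close>. The Bezout multiple \<open>v * b\<close> projects onto the
  \<open>p\<close>-primary part, so it acts as 0 or as the identity. The first would make the
  smaller \<open>b\<close> an exponent; the second makes \<open>p ^ s\<close> one.\<close>

lemma indecomposable_imp_primary_exponent:
  fixes \<alpha> :: "'a::{topological_ab_group_add, t2_space} \<Rightarrow> 'a"
  assumes indec: "indecomposable \<alpha>" and bij: "bij \<alpha>"
    and add: "\<And>x y. \<alpha> (x + y) = \<alpha> x + \<alpha> y"
    and nonzero: "\<exists>x::'a. x \<noteq> 0" and m: "m \<ge> 1" "\<And>x::'a. int m \<cdot> x = 0"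
  obtains p :: nat and r where "prime p" "\<And>x::'a. (int p ^ Suc r) \<cdot> x = 0" "\<exists>x::'a. int p ^ r \<cdot> x \<noteq> 0"
proof -
  define P where "P d \<longleftrightarrow> d \<ge> 1 \<and> (\<forall>x::'a. int d \<cdot> x = 0)" for d
  define d where "d = (LEAST d. P d)"
  have "P m" using m by (simp add: P_def)
  then have Pd: "P d" unfolding d_def by (rule LeastI)
  have least: "\<not> P k" if "k < d" for k using that unfolding d_def by (rule not_less_Least)
  have "\<not> P 1" using nonzero by (simp add: P_def)
  then have "d \<noteq> 1" using Pd by metis
  then obtain p where p: "prime p" "p dvd d" using prime_factor_nat by blast
  have d0: "d \<noteq> 0" using Pd by (simp add: P_def)
  then obtain s b where sb: "\<not> p dvd b" "d = p ^ s * b"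
    using multiplicity_decompose'[of d p] p(1) by (metis not_prime_unit)
  have "s \<noteq> 0" using sb p(2) by (metis mult_1 power_0)
  then obtain r where s: "s = Suc r" by (cases s) auto
  have cop: "coprime (int (p ^ s)) (int b)"
    using sb p(1) by (simp add: prime_imp_coprime)
  then obtain u v where uv: "u * int (p ^ s) + v * int b = 1"
    by (metis bezout_int coprime_iff_gcd_eq_1)
  define e where "e x = (v * int b) \<cdot> x" for x :: 'a
  have cont: "continuous_on UNIV e"
  proof -
    have "continuous_on UNIV (nat_mult k :: 'a \<Rightarrow> 'a)" for k
      unfolding nat_mult_def by (intro continuous_intros)
    then show ?thesis unfolding e_def int_mult_def by (intro continuous_intros)
  qed
  have kill: "(w * int d) \<cdot> x = 0" for w and x :: 'a
    using Pd unfolding P_def by (metis int_module.scale_scale int_module.scale_zero_right)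
  have e1: "e x = x - (u * int (p ^ s)) \<cdot> x" for x
    unfolding e_def by (metis uv add_diff_cancel_left' int_module.scale_left_distrib int_module.scale_one)
  have "(\<forall>x. e x = 0) \<or> (\<forall>x. e x = x)"
  proof (rule indecomposable_imp_trivial_idempotent[OF indec bij add _ cont])
    show "e (x + y) = e x + e y" for x y by (simp add: e_def int_module.scale_right_distrib)
    show "e (e x) = e x" for x
    proof -
      \<comment> \<open>The product of the complementary multiples \<open>u * p ^ s\<close> and
        \<open>v * b\<close> is divisible by \<open>d\<close>, so it acts as 0.\<close>
      have "(u * int (p ^ s)) \<cdot> e x = (u * v * int d) \<cdot> x"
        unfolding e_def by (simp add: sb(2) algebra_simps)
      then show ?thesis using kill e1[of "e x"] by simp
    qed
    show "e (\<alpha> x) = \<alpha> (e x)" for x unfolding e_def by (rule int_mult_additive[symmetric]) (rule add)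
  qed
  then have e: "e x = x" for x
  proof
    assume e0: "\<forall>x. e x = 0"
    have "int b \<cdot> x = 0" for x :: 'a
    proof -
      have "int b \<cdot> e x = int b \<cdot> x - (u * int d) \<cdot> x"
        unfolding e1 by (simp add: sb(2) int_module.scale_right_diff_distrib algebra_simps)
      then show ?thesis using e0 kill by simp
    qed
    then have "P b" using sb d0 by (cases b) (auto simp: P_def)
    moreover have "1 < p ^ s" using prime_gt_1_nat[OF p(1)] s by (intro one_less_power) auto
    then have "b < d" using sb(2) d0 by simp
    ultimately show ?thesis using least by blast
  qed blast
  have pow: "int (p ^ s) \<cdot> x = 0" for x :: 'a
  proof -
    have "int (p ^ s) \<cdot> x = int (p ^ s) \<cdot> e x" by (simp add: e)
    also have "\<dots> = (v * int d) \<cdot> x" by (simp add: e_def sb(2) algebra_simps)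
    finally show ?thesis using kill by simp
  qed
  have "p ^ r < p ^ s" using prime_gt_1_nat[OF p(1)] s by (intro power_strict_increasing) auto
  also have "\<dots> \<le> d" using sb(2) d0 by (metis dvd_imp_le dvd_triv_left neq0_conv)
  finally have "\<not> P (p ^ r)" by (rule least)
  then have "\<exists>x::'a. int p ^ r \<cdot> x \<noteq> 0"
    using p(1) by (auto simp: P_def Suc_le_eq prime_gt_0_nat)
  then show thesis using that[of p r] p(1) pow s by simp
qed

section \<open>Assembly of the isomorphism with the Laurent series\<close>

theorem mainTheorem12:
  fixes \<alpha> :: "'a::{topological_ab_group_add, t2_space} \<Rightarrow> 'a"
  assumes lc: "locally_compact_space (euclidean :: 'a topology)"
    and hom: "homeomorphic_map euclidean euclidean \<alpha>"
    and add: "\<And>x y. \<alpha> (x + y) = \<alpha> x + \<alpha> y"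
    and contr: "\<And>x. (\<lambda>n. (\<alpha> ^^ n) x) \<longlonglongrightarrow> 0"
    and nonzero: "\<exists>x::'a. x \<noteq> 0"
    and tors: "\<exists>m::nat. m \<ge> 1 \<and> (\<forall>x::'a. nat_mult m x = 0)"
    and indec: "indecomposable \<alpha>"
  shows "\<exists>p n. prime (p::nat) \<and> n \<ge> 1 \<and>
           (\<exists>\<phi> :: 'a \<Rightarrow> (int \<Rightarrow> int).
              bij_betw \<phi> UNIV (laurent (int p ^ n))
            \<and> (\<forall>x y. \<phi> (x + y) = laurent_add (int p ^ n) (\<phi> x) (\<phi> y))
            \<and> (\<forall>x. \<phi> (\<alpha> x) = laurent_shift (\<phi> x))
            \<and> homeomorphic_map euclidean (laurent_top (int p ^ n)) \<phi>)"
proof -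
  obtain m :: nat where m: "m \<ge> 1" "\<And>x::'a. int m \<cdot> x = 0"
    using tors by (auto simp: int_mult_of_nat)
  obtain K where "contraction_lattice \<alpha> K"
    using exists_contraction_lattice[OF lc hom add contr, of "int m"] m by auto
  then interpret contraction_lattice \<alpha> K .
  obtain p :: nat and r and x0 :: 'a where prime: "prime p" and expo: "\<And>x::'a. (int p ^ Suc r) \<cdot> x = 0"
    and x0: "int p ^ r \<cdot> x0 \<noteq> 0"
    using indecomposable_imp_primary_exponent[OF indec bij add nonzero m] by metis
  \<comment> \<open>The \<open>U i\<close> intersect in 0, so one of them misses
    \<open>p ^ r \<cdot> x0\<close>; the character built from it vanishes on an open
    subgroup.\<close>
  obtain j where j: "int p ^ r \<cdot> x0 \<notin> U j" using U_Inter x0 by blast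
  have p': "prime (int p)" using prime by simp
  obtain \<psi> :: "'a \<Rightarrow> int" where \<psi>: "\<And>x. 0 \<le> \<psi> x" "\<And>x. \<psi> x < int p ^ Suc r"
    "\<And>x y. \<psi> (x + y) = (\<psi> x + \<psi> y) mod int p ^ Suc r"
    "\<And>u. u \<in> U j \<Longrightarrow> \<psi> u = 0" "\<psi> x0 = 1"
    using exists_coordinate_character[OF p' expo subgroup_U j] by blast
  interpret laurent_character \<alpha> K "int p" "int p ^ Suc r" "Suc r" \<psi> x0 j
    using p' expo \<psi> by unfold_locales auto
  have "(\<lambda>k. if k = 0 then 1 else 0) \<in> laurent (int p ^ Suc r)"
    using q_gt_1 prime_gt_0_nat[OF prime] by (auto simp: laurent_def simp del: power_Suc)
  then obtain y where y: "lcoeff y = (\<lambda>k. if k = 0 then 1 else 0)" by (rule exists_lcoeff_eq)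
  obtain c where c: "y \<in> U c" using U_absorb by blast
  interpret laurent_section \<alpha> K "int p" "int p ^ Suc r" "Suc r" \<psi> x0 j y c
    using y c by unfold_locales auto
  have "bij_betw lcoeff UNIV (laurent (int p ^ Suc r))"
    using homeomorphic_map_lcoeff(1)[OF indec] lcoeff_laurent exists_lcoeff_eq
    unfolding bij_betw_def by (metis (no_types, lifting) UNIV_I image_eqI image_subsetI subsetI subset_antisym)
  moreover have "lcoeff (x + z) = laurent_add (int p ^ Suc r) (lcoeff x) (lcoeff z)" for x z
    by (auto simp: laurent_add_def lcoeff_add)
  moreover have "lcoeff (\<alpha> x) = laurent_shift (lcoeff x)" for x
    using lcoeff_T[of 1 x] by (auto simp: laurent_shift_def T_1)
  ultimately show ?thesis
    using prime homeomorphic_map_lcoeff(2)[OF indec]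
    by (intro exI[of _ p] exI[of _ "Suc r"] conjI exI[of _ lcoeff]) auto
qed

end
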